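(* There exists a decreasing function $\gamma\colon (0,\sqrt{2}) \to (0,1]$ such that $\gamma(c) \to 1$ as $c \to 0$ and the following holds for every $c \in (0,\sqrt{2})$, $\alpha \in (0,1]$, and $d \geq 2$. Let $\beta = 1- \big(1-\alpha\cdot \gamma(c)\big)^{1/(2d)}$ and let $\mathcal{F}$ be a finite family of convex sets in $\mathbb{R}^d$. If $\bigcap \mathcal H$ has diameter greater than or equal to $1$ for at least $\alpha \binom{|\mathcal{F}|}{2d}$ subcollections $\mathcal H \subseteq \mathcal{F}$ of $2d$ sets, then there exists a subfamily $\mathcal G \subseteq \mathcal{F}$ such that $|\mathcal G| \ge \beta |\mathcal{F}|$ and the diameter of $\bigcap \mathcal G$ is greater than or equal to $c\, d^{-1/2}$.
   Context: Here $d$ is an integer, the dimension of the space. Diameter is measured in the Euclidean norm: the diameter of a set is the supremum of the distances between pairs of its points. For a family $\mathcal H$ of sets, $\bigcap \mathcal H$ denotes the intersection of all its members.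
   Formalization: The family is assumed to have at least 2d members; with fewer (but at least one), the binomial coefficient is 0, the hypothesis is vacuous, and the claim fails, e.g. for the family consisting of a single one-point set. *)

theory Defs
  imports "HOL-Analysis.Analysis" "HOL-Library.Function_Algebras"
begin

text \<open>
  The dimension \<open>d\<close> is quantified inside the theorem (one function \<open>\<gamma>\<close> serves all dimensions), so
  it cannot be a type parameter. Points of $d$-dimensional space are the functions
  \<open>x :: nat \<Rightarrow> real\<close> that vanish from index \<open>d\<close> on, i.e. the elements of
  \<open>topspace (Euclidean_space d)\<close>. The pointwise vector space structure makes the library
  predicate \<open>convex\<close> available for sets of such functions.
\<close>

instantiation "fun" :: (type, real_vector) real_vector
begin

definition scaleR_fun :: "real \<Rightarrow> ('a \<Rightarrow> 'b) \<Rightarrow> 'a \<Rightarrow> 'b" where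
  "scaleR_fun r f = (\<lambda>x. r *\<^sub>R f x)"

instance
  by standard (simp_all add: scaleR_fun_def fun_eq_iff scaleR_add_right scaleR_add_left)

end

lemma scaleR_fun_apply [simp]: "(r *\<^sub>R f) x = r *\<^sub>R f x"
  by (simp add: scaleR_fun_def)

text \<open>
  The type class operation \<open>dist\<close> on \<open>nat \<Rightarrow> real\<close> metrizes the product topology; it is not the
  Euclidean distance. The latter is given by \<open>L2_set\<close>, exactly as for the type \<open>real ^ 'n\<close>.
\<close>

definition euclid_dist :: "nat \<Rightarrow> (nat \<Rightarrow> real) \<Rightarrow> (nat \<Rightarrow> real) \<Rightarrow> real" where
  "euclid_dist d x y = L2_set (\<lambda>i. x i - y i) {..<d}"

text \<open>
  The supremum is taken in \<open>ennreal\<close>, so that unbounded sets have diameter \<open>\<infinity>\<close> (the real-valued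
  library constant \<open>diameter\<close> is not meaningful for them) and the empty set has diameter 0.
\<close>

definition euclid_diameter :: "nat \<Rightarrow> (nat \<Rightarrow> real) set \<Rightarrow> ennreal" where
  "euclid_diameter d S = (SUP (x, y) \<in> S \<times> S. ennreal (euclid_dist d x y))"

end

theory Submission
  imports Defs "HOL-Probability.Probability" "HOL-Computational_Algebra.Polynomial"
begin

text \<open>
  Why the theorem holds. For a fixed vector \<open>v\<close> and width \<open>w > 0\<close>, replace every member \<open>K\<close> of the
  family by the convex set of those pairs \<open>(x, y) \<in> K \<times> K\<close> with \<open>\<langle>v, y - x\<rangle> = w\<close>. These sets live in an
  affine space of dimension \<open>2d - 1\<close>, so intersection statements about them involve subfamilies of
  \<open>2d\<close> members; and when \<open>v\<close> is a unit vector, a pair common to a subfamily shows that its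
  intersection has diameter at least \<open>w\<close>. Two ingredients remain.

  The first is the choice of \<open>v\<close>. Each of the given \<open>2d\<close>-member subfamilies has a segment of length
  about \<open>1\<close> in its intersection. A random Gaussian vector \<open>g\<close> satisfies
  \<open>d \<langle>u, g\<rangle>\<^sup>2 \<ge> c\<^sup>2 \<bar>g\<bar>\<^sup>2\<close> with a probability that, for \<open>c < sqrt 2\<close>, is bounded below by a positive
  \<open>dir_prob c\<close>, uniformly in \<open>d \<ge> 2\<close> and in the unit vector \<open>u\<close>, and the bound tends to \<open>1\<close> as
  \<open>c \<rightarrow> 0\<close>. Averaging over the segments gives one direction \<open>v\<close> in which a proportion \<open>dir_prob c\<close>
  of them have width at least \<open>c / sqrt d\<close> (lemma \<open>exists_common_direction\<close>).

  The second is the fractional Helly theorem in dimension \<open>k - 1\<close> with the optimal dependence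
  \<open>\<beta> = 1 - (1 - a) powr (1/k)\<close> (lemma \<open>fractional_helly\<close>), used with \<open>k = 2d\<close>. If no more than \<open>m\<close>
  of the \<open>n\<close> sets have a common point, then at least \<open>(n - m)\<^sup>k\<close> of the \<open>n\<^sup>k\<close> tuples of \<open>k\<close> indices
  belong to families with empty intersection. The reason is algebraic. Take a linear code on the
  \<open>n\<close> indices of dimension \<open>n - m\<close> in which any \<open>n - m\<close> coordinates determine a codeword,
  and consider the \<open>k\<close>-th tensor power of the code, a space of functions on the \<open>k\<close>-tuples of
  dimension \<open>(n - m)\<^sup>k\<close>. A member of this space that vanishes on all non-intersecting tuples vanishes
  everywhere: the intersecting families can be removed one after the other, those whose
  intersection stays farthest from the origin first. A family \<open>S\<close> is removed together with all
  remaining families that contain a certain subfamily \<open>\<sigma> \<subseteq> S\<close> of fewer than \<open>k\<close> sets, and each of these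
  lies in one family \<open>\<tau>\<close> of at most \<open>m\<close> sets. In a tuple with entries \<open>S\<close> some position
  is not needed to cover \<open>\<sigma>\<close>; the values obtained by
  changing that position form a codeword that vanishes at the \<open>n - m\<close> or more indices outside \<open>\<tau>\<close>,
  hence at all indices. The dimension is therefore at most the number of non-intersecting tuples.
\<close>

section \<open>A code determined by any few coordinates\<close>

lemma sum_fun_apply:
  fixes g :: "'b \<Rightarrow> 'c \<Rightarrow> 'd :: comm_monoid_add"
  shows "(\<Sum>z\<in>Z. g z) s = (\<Sum>z\<in>Z. g z s)"
  by (induction Z rule: infinite_finite_induct) (auto simp: zero_fun_def plus_fun_def)


lemma lagrange_interpolation:
  fixes p :: "real poly"
  assumes "finite Z" "degree p < card Z"
  shows "poly p x = (\<Sum>z\<in>Z. poly p z * (\<Prod>y\<in>Z-{z}. (x - y) / (z - y)))"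
proof -
  define q where "q = (\<Sum>z\<in>Z. smult (poly p z) (\<Prod>y\<in>Z-{z}. smult (inverse (z - y)) [:-y, 1:]))"
  have ev: "poly q t = (\<Sum>z\<in>Z. poly p z * (\<Prod>y\<in>Z-{z}. (t - y) / (z - y)))" for t
    by (simp add: q_def poly_sum poly_prod divide_inverse algebra_simps)
  have "poly q t = poly p t" if t: "t \<in> Z" for t
  proof -
    have "(\<Prod>y\<in>Z-{z}. (t - y) / (z - y)) = (if z = t then 1 else 0)" if "z \<in> Z" for z
      using t assms(1) that by auto
    hence "poly q t = (\<Sum>z\<in>Z. if t = z then poly p z else 0)"
      unfolding ev by (intro sum.cong) auto
    thus ?thesis using t assms(1) by simp
  qed
  hence roots: "Z \<subseteq> {t. poly (q - p) t = 0}" by auto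
  have "degree (\<Prod>y\<in>Z-{z}. smult (inverse (z - y)) [:-y, 1:]) < card Z" if "z \<in> Z" for z
  proof -
    have "degree (\<Prod>y\<in>Z-{z}. smult (inverse (z - y)) [:-y, 1:]) 
      \<le> (\<Sum>y\<in>Z-{z}. degree (smult (inverse (z - y)) [:-y, 1:]))"
      using degree_prod_sum_le[of "Z-{z}" "\<lambda>y. smult (inverse (z - y)) [:-y, 1:]"] assms(1) by (simp add: o_def)
    also have "\<dots> \<le> (\<Sum>y\<in>Z-{z}. 1)" by (intro sum_mono) auto
    also have "\<dots> < card Z" using card_Diff1_less[OF assms(1) that] by (simp del: card_Diff_singleton)
    finally show ?thesis .
  qed
  hence "degree q < card Z" unfolding q_def using assms
    by (intro degree_sum_less) (auto intro: le_less_trans[OF degree_smult_le])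
  hence deg: "degree (q - p) < card Z" using assms(2) by (intro degree_diff_less)
  have "q - p = 0"
  proof (rule ccontr)
    assume ne: "q - p \<noteq> 0"
    have "card Z \<le> card {t. poly (q - p) t = 0}"
      using roots poly_roots_finite[OF ne] by (intro card_mono) auto
    also have "\<dots> \<le> degree (q - p)" by (rule card_poly_roots_bound[OF ne])
    finally show False using deg by simp
  qed
  hence "poly p x = poly q x" by simp
  thus ?thesis by (simp only: ev)
qed

text \<open>
  The rows \<open>v x\<close> evaluate the polynomials of degree below \<open>b\<close> at points indexed by \<open>X\<close>, in the basis
  of Lagrange polynomials of a \<open>b\<close>-element set \<open>Y\<close>. Since such a polynomial is determined by its values at
  any \<open>b\<close> points, every row is a combination of any \<open>b\<close> rows.
\<close>
lemma reed_solomon_code: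
  fixes X :: "'i set"
  assumes "finite X" "b \<le> card X"
  obtains Y :: "'i set" and v :: "'i \<Rightarrow> 'i \<Rightarrow> real"
  where "Y \<subseteq> X" "card Y = b" "\<And>x y. x \<in> Y \<Longrightarrow> v x y = (if x = y then 1 else 0)"
    "\<And>x Z. x \<in> X \<Longrightarrow> Z \<subseteq> X \<Longrightarrow> b \<le> card Z \<Longrightarrow> \<exists>c. \<forall>y. v x y = (\<Sum>z\<in>Z. c z * v z y)"
proof -
  obtain Y where Y: "Y \<subseteq> X" "card Y = b" using obtain_subset_with_card_n[OF assms(2)] by metis
  have finY: "finite Y" using Y assms finite_subset by auto
  obtain h0 :: "'i \<Rightarrow> nat" where h0: "inj_on h0 X" using finite_imp_inj_to_nat_seg[OF assms(1)] by auto
  define h where "h = (\<lambda>x. real (h0 x))"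
  have h: "inj_on h X" using h0 by (auto simp: h_def inj_on_def)
  have hne: "h x \<noteq> h y" if "x \<in> X" "y \<in> X" "x \<noteq> y" for x y using h that by (auto simp: inj_on_def)
  define l where "l = (\<lambda>y. \<Prod>y'\<in>Y-{y}. smult (inverse (h y - h y')) [:-h y', 1:])"
  define v where "v = (\<lambda>x y. if y \<in> Y then poly (l y) (h x) else 0)"
  have lev: "poly (l y) t = (\<Prod>y'\<in>Y-{y}. (t - h y') / (h y - h y'))" for y t
    by (simp add: l_def poly_prod divide_inverse algebra_simps)
  have 1: "v x y = (if x = y then 1 else 0)" if x: "x \<in> Y" for x y
  proof (cases "y \<in> Y \<and> x \<noteq> y")
    case True
    hence "(\<Prod>y'\<in>Y-{y}. (h x - h y') / (h y - h y')) = 0" using x finY by (intro prod_zero) auto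
    thus ?thesis using True by (simp add: v_def lev)
  next
    case False
    have "(\<Prod>y'\<in>Y-{x}. (h x - h y') / (h x - h y')) = 1"
      using hne Y x by (intro prod.neutral) (force)
    thus ?thesis using False x by (auto simp: v_def lev)
  qed
  have deg: "degree (l y) < b" if "y \<in> Y" for y
  proof -
    have "degree (l y) \<le> (\<Sum>y'\<in>Y-{y}. degree (smult (inverse (h y - h y')) [:-h y', 1:]))"
      using degree_prod_sum_le[of "Y-{y}" "\<lambda>y'. smult (inverse (h y - h y')) [:-h y', 1:]"] finY by (simp add: o_def l_def)
    also have "\<dots> \<le> (\<Sum>y'\<in>Y-{y}. 1)" by (intro sum_mono) auto
    also have "\<dots> < b" using card_Diff1_less[OF finY that] Y by (simp del: card_Diff_singleton)
    finally show ?thesis .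
  qed
  have 2: "\<exists>c. \<forall>y. v x y = (\<Sum>z\<in>Z. c z * v z y)" if Z: "x \<in> X" "Z \<subseteq> X" "b \<le> card Z" for x Z
  proof -
    have injZ: "inj_on h Z" using h Z by (meson inj_on_subset)
    have finZ: "finite Z" using Z assms finite_subset by auto
    define c where "c = (\<lambda>z. \<Prod>t\<in>h ` Z - {h z}. (h x - t) / (h z - t))"
    have "v x y = (\<Sum>z\<in>Z. c z * v z y)" for y
    proof (cases "y \<in> Y")
      case True
      have "poly (l y) (h x) = (\<Sum>z\<in>h ` Z. poly (l y) z * (\<Prod>t\<in>h ` Z-{z}. (h x - t) / (z - t)))"
        using deg[OF True] Z(3) finZ by (intro lagrange_interpolation) (auto simp: card_image[OF injZ])
      also have "\<dots> = (\<Sum>z\<in>Z. poly (l y) (h z) * c z)"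
        by (simp add: sum.reindex[OF injZ] c_def)
      finally show ?thesis using True by (simp add: v_def mult.commute)
    qed (simp add: v_def)
    thus ?thesis by blast
  qed
  show thesis using that[OF Y 1 2] by blast
qed

section \<open>Tuples outside a collapsible complex\<close>

text \<open>
  The hypothesis is a numerical form of collapsibility, with \<open>f\<close> giving the order of the collapse: a
  face \<open>S\<close> disappears together with the faces above \<open>\<sigma>\<close>, and \<open>\<tau>\<close> contains all faces above \<open>\<sigma>\<close>
  that are still present. The proof is dual to the vanishing argument: the evaluation vectors
  \<open>E t\<close> of all tuples lie in the span of those of the non-faces, so there are at least as many
  non-faces as the \<open>b\<^sup>k\<close> independent vectors \<open>E t\<close> with entries in \<open>Y\<close>.
\<close>

lemma tuples_outside_collapsible_complex:
  fixes X :: "'i set" and N :: "'i set set" and f :: "'i set \<Rightarrow> real"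
  assumes fin: "finite X" and k: "k \<ge> 1"
    and collapse: "\<And>S. S \<in> N \<Longrightarrow> S \<subseteq> X \<Longrightarrow> S \<noteq> {} \<Longrightarrow> \<exists>\<sigma> \<tau>. \<sigma> \<subseteq> S \<and> card \<sigma> < k \<and> \<tau> \<subseteq> X \<and> card \<tau> \<le> m \<and>
      (\<forall>T\<in>N. T \<subseteq> X \<longrightarrow> \<sigma> \<subseteq> T \<longrightarrow> \<not> T \<subseteq> \<tau> \<longrightarrow> f S < f T)"
  shows "(card X - m) ^ k \<le> card {t. set t \<subseteq> X \<and> length t = k \<and> set t \<notin> N}"
proof -
  define b where "b = card X - m"
  have bX: "b \<le> card X" by (simp add: b_def)
  obtain Y and v :: "'i \<Rightarrow> 'i \<Rightarrow> real" where Y: "Y \<subseteq> X" "card Y = b"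
    and vY: "\<And>x y. x \<in> Y \<Longrightarrow> v x y = (if x = y then 1 else 0)"
    and v: "\<And>x Z. x \<in> X \<Longrightarrow> Z \<subseteq> X \<Longrightarrow> b \<le> card Z \<Longrightarrow> \<exists>c. \<forall>y. v x y = (\<Sum>z\<in>Z. c z * v z y)"
    by (rule reed_solomon_code[OF fin bX]) blast
  have finY: "finite Y" using Y fin finite_subset by auto
  \<comment> \<open>\<open>E t\<close> is the tensor product of the rows \<open>v (t ! j)\<close>; replacing one entry of \<open>t\<close> acts on a single factor.\<close>
  define E where "E = (\<lambda>t s. if length s = k then \<Prod>j<k. v (t ! j) (s ! j) else 0)"
  define M where "M = {t. set t \<subseteq> X \<and> length t = k \<and> set t \<notin> N}"
  define YK where "YK = {t. set t \<subseteq> Y \<and> length t = k}"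
  have finM: "finite M" unfolding M_def by (rule finite_subset[OF _ finite_lists_length_eq[OF fin, of k]]) auto
  have finYK: "finite YK" unfolding YK_def by (rule finite_lists_length_eq[OF finY])
  have E_upd: "\<exists>c. E (t[j := x]) = (\<Sum>z\<in>Z. c z *\<^sub>R E (t[j := z]))"
    if "length t = k" "j < k" "x \<in> X" "Z \<subseteq> X" "b \<le> card Z" for t j x Z
  proof -
    have "\<exists>c. \<forall>y. v x y = (\<Sum>z\<in>Z. c z * v z y)" by (rule v[OF that(3-5)])
    then obtain c where c: "\<And>y. v x y = (\<Sum>z\<in>Z. c z * v z y)" by blast
    have split: "(\<Prod>i<k. v (t[j := z] ! i) (s ! i)) = v z (s ! j) * (\<Prod>i\<in>{..<k}-{j}. v (t ! i) (s ! i))" for z s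
    proof -
      have "(\<Prod>i<k. v (t[j := z] ! i) (s ! i)) = v (t[j := z] ! j) (s ! j) * (\<Prod>i\<in>{..<k}-{j}. v (t[j := z] ! i) (s ! i))"
        using that by (intro prod.remove) auto
      also have "(\<Prod>i\<in>{..<k}-{j}. v (t[j := z] ! i) (s ! i)) = (\<Prod>i\<in>{..<k}-{j}. v (t ! i) (s ! i))"
        by (intro prod.cong) auto
      finally show ?thesis using that by simp
    qed
    have "E (t[j := x]) s = (\<Sum>z\<in>Z. c z *\<^sub>R E (t[j := z])) s" for s
      by (simp add: sum_fun_apply E_def split c sum_distrib_right mult.assoc)
    hence "E (t[j := x]) = (\<Sum>z\<in>Z. c z *\<^sub>R E (t[j := z]))" by (rule ext)
    thus ?thesis by (intro exI[of _ c])
  qed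
  have main: "E t \<in> span (E ` M)" if "set t \<subseteq> X" "length t = k" for t
    using that
  proof (induction "card {T\<in>N. T \<subseteq> X \<and> f (set t) < f T}" arbitrary: t rule: less_induct)
    case less
    show ?case
    proof (cases "set t \<in> N")
      case False
      thus ?thesis using less.prems by (intro span_base) (auto simp: M_def)
    next
      case True
      have ne: "set t \<noteq> {}" using less.prems k by auto
      obtain \<sigma> \<tau> where col: "\<sigma> \<subseteq> set t \<and> card \<sigma> < k \<and> \<tau> \<subseteq> X \<and> card \<tau> \<le> m \<and>
          (\<forall>T\<in>N. T \<subseteq> X \<longrightarrow> \<sigma> \<subseteq> T \<longrightarrow> \<not> T \<subseteq> \<tau> \<longrightarrow> f (set t) < f T)"
        using collapse[OF True less.prems(1) ne] by (elim exE)
      hence s: "\<sigma> \<subseteq> set t" "card \<sigma> < k" "\<tau> \<subseteq> X" "card \<tau> \<le> m" by simp_all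
      have up: "f (set t) < f T" if "T \<in> N" "T \<subseteq> X" "\<sigma> \<subseteq> T" "\<not> T \<subseteq> \<tau>" for T
        using col that by blast
      obtain J where J: "J \<subseteq> {..<k}" "inj_on ((!) t) J" "(!) t ` J = \<sigma>"
      proof -
        have "\<sigma> \<subseteq> (\<lambda>i. t ! i) ` {..<k}" using s(1) less.prems by (auto simp: set_conv_nth)
        thus thesis using that subset_image_inj[of \<sigma> "(!) t" "{..<k}"] by auto
      qed
      \<comment> \<open>\<open>J\<close> selects one position for each element of \<open>\<sigma>\<close>, so some position \<open>j\<close> is free to vary.\<close>
      have "card J < k" using J s by (metis card_image)
      hence "J \<noteq> {..<k}" by auto
      then obtain j where j: "j < k" "j \<notin> J" using J by auto
      have sub: "\<sigma> \<subseteq> set (t[j := x])" for x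
      proof
        fix y assume "y \<in> \<sigma>"
        then obtain i where "i \<in> J" "y = t ! i" using J by auto
        moreover from this have "i \<noteq> j" "i < length (t[j := x])" using j J less.prems by auto
        ultimately show "y \<in> set (t[j := x])" using nth_mem[of i "t[j := x]"] by simp
      qed
      have known: "E (t[j := x]) \<in> span (E ` M)" if x: "x \<in> X - \<tau>" for x
      proof (cases "set (t[j := x]) \<in> N")
        case False
        moreover have "set (t[j := x]) \<subseteq> X" using less.prems x set_update_subset_insert[of t j x] by auto
        ultimately have "t[j := x] \<in> M" using less.prems by (simp add: M_def)
        thus ?thesis by (intro span_base imageI)
      next
        case T: True
        have TX: "set (t[j := x]) \<subseteq> X" using less.prems x set_update_subset_insert[of t j x] by auto
        have "x \<in> set (t[j := x])" using j less.prems by (simp add: set_update_memI)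
        hence "\<not> set (t[j := x]) \<subseteq> \<tau>" using x by auto
        hence lt: "f (set t) < f (set (t[j := x]))" using up[OF T TX sub] by blast
        have "{T\<in>N. T \<subseteq> X \<and> f (set (t[j := x])) < f T} \<subset> {T\<in>N. T \<subseteq> X \<and> f (set t) < f T}"
          using lt T TX by fastforce
        hence "card {T\<in>N. T \<subseteq> X \<and> f (set (t[j := x])) < f T} < card {T\<in>N. T \<subseteq> X \<and> f (set t) < f T}"
          using fin by (intro psubset_card_mono) (auto intro: finite_subset[of _ "Pow X"])
        thus ?thesis using less.hyps[of "t[j := x]"] TX less.prems by simp
      qed
      have "b \<le> card (X - \<tau>)" using s fin by (simp add: b_def card_Diff_subset finite_subset)
      moreover have "t ! j \<in> X" using j less.prems by (auto simp: subset_iff)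
      ultimately obtain c where "E (t[j := t ! j]) = (\<Sum>z\<in>X - \<tau>. c z *\<^sub>R E (t[j := z]))"
        using E_upd[OF less.prems(2) j(1), of "t ! j" "X - \<tau>"] by blast
      hence "E t = (\<Sum>z\<in>X - \<tau>. c z *\<^sub>R E (t[j := z]))" by simp
      also have "\<dots> \<in> span (E ` M)" by (intro span_sum span_scale known)
      finally show ?thesis .
    qed
  qed
  have Edelta: "E t s = (if s = t then 1 else 0)" if t: "t \<in> YK" for s t
  proof (cases "length s = k")
    case True
    have *: "E t s = (\<Prod>j<k. if t ! j = s ! j then 1 else 0)" using t True
      by (auto simp: E_def YK_def subset_iff intro!: prod.cong vY)
    show ?thesis
    proof (cases "s = t")
      case False
      then obtain i where "i < k" "t ! i \<noteq> s ! i" using True t by (auto simp: YK_def list_eq_iff_nth_eq)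
      hence "(\<Prod>j<k. if t ! j = s ! j then 1 else 0 :: real) = 0" by (intro prod_zero) auto
      thus ?thesis using * False by simp
    qed (use * in auto)
  qed (use t in \<open>auto simp: E_def YK_def\<close>)
  have injE: "inj_on E YK"
  proof (rule inj_onI)
    fix s t assume *: "s \<in> YK" "t \<in> YK" "E s = E t"
    have "E t s = 1" using Edelta[of s s] * by simp
    thus "s = t" using Edelta[of t s] * by (auto split: if_splits)
  qed
  have "independent (E ` YK)"
  proof -
    have "u w = 0" if "(\<Sum>x\<in>E ` YK. u x *\<^sub>R x) = 0" "w \<in> E ` YK" for u w
    proof -
      from that(2) obtain s where s: "s \<in> YK" "w = E s" by auto
      have "0 = (\<Sum>t\<in>YK. u (E t) *\<^sub>R E t) s" using that(1) by (simp add: sum.reindex[OF injE])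
      also have "\<dots> = (\<Sum>t\<in>YK. if s = t then u (E t) else 0)"
        unfolding sum_fun_apply by (intro sum.cong) (auto simp: Edelta)
      also have "\<dots> = u w" using s finYK by simp
      finally show ?thesis by simp
    qed
    thus ?thesis using dependent_finite[of "E ` YK"] finYK by auto
  qed
  moreover have "E ` YK \<subseteq> span (E ` M)" using main Y by (auto simp: YK_def)
  ultimately have "card (E ` YK) \<le> card (E ` M)"
    using independent_span_bound[of "E ` M" "E ` YK"] finM by auto
  also have "\<dots> \<le> card M" using finM by (rule card_image_le)
  finally have "card YK \<le> card M" by (simp add: card_image[OF injE])
  thus ?thesis using Y finY by (simp add: YK_def M_def card_lists_length_eq b_def)
qed

section \<open>From tuples to subsets\<close>

lemma card_supersets:
  assumes "finite X" "s \<subseteq> X" "card s \<le> k"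
  shows "card {S. s \<subseteq> S \<and> S \<subseteq> X \<and> card S = k} = (card X - card s) choose (k - card s)"
proof -
  have fs: "finite s" using assms finite_subset by auto
  have "bij_betw (\<lambda>T. T \<union> s) {T. T \<subseteq> X - s \<and> card T = k - card s} {S. s \<subseteq> S \<and> S \<subseteq> X \<and> card S = k}"
  proof (rule bij_betwI[where g = "\<lambda>S. S - s"])
    show "(\<lambda>T. T \<union> s) \<in> {T. T \<subseteq> X - s \<and> card T = k - card s} \<rightarrow> {S. s \<subseteq> S \<and> S \<subseteq> X \<and> card S = k}"
    proof (rule funcsetI, clarsimp)
      fix T assume T: "T \<subseteq> X - s" "card T = k - card s"
      have "card (T \<union> s) = card T + card s" using T assms fs finite_subset
        by (intro card_Un_disjoint) (auto intro: finite_subset[of T X])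
      thus "T \<subseteq> X \<and> s \<subseteq> X \<and> card (T \<union> s) = k" using T assms by auto
    qed
    show "(\<lambda>S. S - s) \<in> {S. s \<subseteq> S \<and> S \<subseteq> X \<and> card S = k} \<rightarrow> {T. T \<subseteq> X - s \<and> card T = k - card s}"
      using fs by (auto simp: card_Diff_subset)
  qed auto
  hence "card {S. s \<subseteq> S \<and> S \<subseteq> X \<and> card S = k} = card {T. T \<subseteq> X - s \<and> card T = k - card s}"
    by (simp add: bij_betw_same_card)
  also have "\<dots> = card (X - s) choose (k - card s)" using assms by (intro n_subsets) auto
  finally show ?thesis using assms fs by (simp add: card_Diff_subset)
qed

text \<open>
  A random tuple is a non-face at most as often as a random \<open>k\<close>-subset: tuple and subset can be
  coupled so that the subset contains the entries of the tuple, and supersets of non-faces are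
  non-faces. The weights \<open>w\<close> are this coupling: spreading the mass of \<open>t\<close> evenly over
  the \<open>k\<close>-sets that contain its entries gives, by symmetry, each \<open>k\<close>-set the same total mass.
\<close>
lemma missing_tuples_le_missing_subsets:
  fixes X :: "'i set" and N :: "'i set set"
  assumes fin: "finite X" and kX: "k \<le> card X"
    and down: "\<And>S T. S \<in> N \<Longrightarrow> T \<subseteq> S \<Longrightarrow> T \<in> N"
  shows "real (card {t. set t \<subseteq> X \<and> length t = k \<and> set t \<notin> N}) * real (card X choose k)
    \<le> real (card X) ^ k * real (card {S. S \<subseteq> X \<and> card S = k \<and> S \<notin> N})"
proof -
  define TT where "TT = {t. set t \<subseteq> X \<and> length t = k}"
  define SS where "SS = {S. S \<subseteq> X \<and> card S = k}"
  define ch where "ch = (\<lambda>s :: 'i set. real ((card X - card s) choose (k - card s)))"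
  define w where "w = (\<lambda>t :: 'i list. 1 / ch (set t))"
  define W where "W = (\<lambda>S. \<Sum>t | set t \<subseteq> S \<and> length t = k. w t)"
  have finTT: "finite TT" unfolding TT_def by (rule finite_lists_length_eq[OF fin])
  have finSS: "finite SS" unfolding SS_def using fin by (auto intro: finite_subset[of _ "Pow X"])
  have chpos: "ch (set t) > 0" if "t \<in> TT" for t
    using kX card_length[of t] that by (auto simp: ch_def TT_def intro!: diff_le_mono)
  have chcard: "real (card {S\<in>SS. set t \<subseteq> S}) = ch (set t)" if "t \<in> TT" for t
  proof -
    have "{S\<in>SS. set t \<subseteq> S} = {S. set t \<subseteq> S \<and> S \<subseteq> X \<and> card S = k}" by (auto simp: SS_def)
    thus ?thesis using card_supersets[OF fin, of "set t" k] that card_length[of t] by (auto simp: ch_def TT_def)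
  qed
  \<comment> \<open>Each tuple distributes total mass one; \<open>P\<close> will be trivial or membership among the non-faces.\<close>
  have swap: "(\<Sum>S\<in>SS. \<Sum>t | t \<in> TT \<and> set t \<subseteq> S \<and> P t. w t) = real (card {t\<in>TT. P t})" for P
  proof -
    have "(\<Sum>S\<in>SS. \<Sum>t | t \<in> TT \<and> set t \<subseteq> S \<and> P t. w t) = (\<Sum>S\<in>SS. \<Sum>t | t \<in> {t\<in>TT. P t} \<and> set t \<subseteq> S. w t)"
      by (intro sum.cong) auto
    also have "\<dots> = (\<Sum>t | t \<in> TT \<and> P t. \<Sum>S | S \<in> SS \<and> set t \<subseteq> S. w t)"
      using finSS finTT by (subst sum.swap_restrict) auto
    also have "\<dots> = (\<Sum>t | t \<in> TT \<and> P t. 1)"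
    proof (intro sum.cong refl)
      fix t assume "t \<in> {t. t \<in> TT \<and> P t}"
      hence "t \<in> TT" by simp
      thus "(\<Sum>S | S \<in> SS \<and> set t \<subseteq> S. w t) = 1" using chpos[of t] chcard[of t] by (simp add: w_def)
    qed
    finally show ?thesis by simp
  qed
  have Wrest: "W S = (\<Sum>t | t \<in> TT \<and> set t \<subseteq> S \<and> True. w t)" if "S \<in> SS" for S
    using that unfolding W_def by (intro sum.cong) (auto simp: TT_def SS_def)
  have Wsym: "W S = W S'" if "S \<in> SS" "S' \<in> SS" for S S'
  proof -
    have "finite S" "finite S'" "card S = card S'" using that fin finite_subset by (auto simp: SS_def)
    then obtain h where h: "bij_betw h S S'" using finite_same_card_bij by blast
    have hin: "inj_on h S" and him: "h ` S = S'" using h by (auto simp: bij_betw_def)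
    have "(\<Sum>t | set t \<subseteq> S' \<and> length t = k. w t) = (\<Sum>t | set t \<subseteq> S \<and> length t = k. w (map h t))"
    proof (rule sum.reindex_bij_betw[symmetric])
      show "bij_betw (map h) {t. set t \<subseteq> S \<and> length t = k} {t. set t \<subseteq> S' \<and> length t = k}"
        unfolding bij_betw_def
      proof
        show "inj_on (map h) {t. set t \<subseteq> S \<and> length t = k}"
          by (intro inj_on_mapI inj_on_subset[OF hin]) auto
        have "t \<in> map h ` {t. set t \<subseteq> S \<and> length t = k}" if "set t \<subseteq> S'" "length t = k" for t
        proof (rule image_eqI)
          show "t = map h (map (inv_into S h) t)"
            using that him by (auto simp: o_def subset_iff f_inv_into_f intro!: map_idI[symmetric])
          show "map (inv_into S h) t \<in> {t. set t \<subseteq> S \<and> length t = k}"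
            using that him by (auto intro!: inv_into_into)
        qed
        hence "{t. set t \<subseteq> S' \<and> length t = k} \<subseteq> map h ` {t. set t \<subseteq> S \<and> length t = k}" by blast
        moreover have "map h ` {t. set t \<subseteq> S \<and> length t = k} \<subseteq> {t. set t \<subseteq> S' \<and> length t = k}"
          unfolding him[symmetric] by (auto intro!: imageI dest: subsetD)
        ultimately show "map h ` {t. set t \<subseteq> S \<and> length t = k} = {t. set t \<subseteq> S' \<and> length t = k}" by blast
      qed
    qed
    also have "\<dots> = (\<Sum>t | set t \<subseteq> S \<and> length t = k. w t)"
    proof (intro sum.cong refl)
      fix t assume "t \<in> {t. set t \<subseteq> S \<and> length t = k}"
      hence "card (h ` set t) = card (set t)" by (intro card_image inj_on_subset[OF hin]) auto
      thus "w (map h t) = w t" by (simp add: w_def ch_def)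
    qed
    finally show ?thesis by (simp add: W_def)
  qed
  obtain S0 where S0: "S0 \<in> SS" using obtain_subset_with_card_n[OF kX] by (auto simp: SS_def)
  have "real (card (SS)) * W S0 = (\<Sum>S\<in>SS. W S)" using Wsym[OF _ S0] by simp
  also have "\<dots> = real (card {t\<in>TT. True})" by (subst swap[symmetric]) (simp add: Wrest)
  also have "\<dots> = real (card X) ^ k" using fin by (simp add: TT_def card_lists_length_eq)
  finally have W0: "real (card X choose k) * W S0 = real (card X) ^ k" using fin by (simp add: SS_def n_subsets)
  have "real (card {t\<in>TT. set t \<notin> N}) = (\<Sum>S\<in>SS. \<Sum>t | t \<in> TT \<and> set t \<subseteq> S \<and> set t \<notin> N. w t)"
    by (rule swap[symmetric])
  also have "\<dots> \<le> (\<Sum>S\<in>SS. if S \<notin> N then W S0 else 0)"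
  proof (rule sum_mono)
    fix S assume S: "S \<in> SS"
    show "(\<Sum>t | t \<in> TT \<and> set t \<subseteq> S \<and> set t \<notin> N. w t) \<le> (if S \<notin> N then W S0 else 0)"
    proof (cases "S \<in> N")
      case True
      have none: "{t. t \<in> TT \<and> set t \<subseteq> S \<and> set t \<notin> N} = {}" using down[OF True] by auto
      show ?thesis unfolding none using True by simp
    next
      case False
      have "(\<Sum>t | t \<in> TT \<and> set t \<subseteq> S \<and> set t \<notin> N. w t) \<le> (\<Sum>t | t \<in> TT \<and> set t \<subseteq> S \<and> True. w t)"
        using finTT chpos by (intro sum_mono2) (auto simp: w_def less_imp_le)
      thus ?thesis using False Wrest[OF S] Wsym[OF S S0] by simp
    qed
  qed
  also have "\<dots> = W S0 * real (card {S\<in>SS. S \<notin> N})"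
    using finSS by (simp add: sum.If_cases Int_def mult.commute)
  finally have "real (card {t\<in>TT. set t \<notin> N}) * real (card X choose k)
      \<le> (W S0 * real (card {S\<in>SS. S \<notin> N})) * real (card X choose k)" by (intro mult_right_mono) auto
  also have "\<dots> = real (card X) ^ k * real (card {S\<in>SS. S \<notin> N})" by (simp add: W0[symmetric])
  finally show ?thesis by (simp add: TT_def SS_def conj_assoc)
qed

section \<open>Nerves of convex sets\<close>

text \<open>
  Helly's theorem by Radon's argument. The dimension of the ambient set \<open>A\<close> is expressed by the affine
  dependence of more than \<open>k\<close> points, because the spaces used below are not Euclidean space types.
  A minimal subfamily \<open>J'\<close> with empty intersection that has more than \<open>k\<close> members would provide points
  \<open>z j\<close> lying in all of its members except \<open>G j\<close>, and a Radon point of these lies in all members.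
\<close>
lemma helly_affine_dependent:
  fixes G :: "'j \<Rightarrow> 'a :: real_vector set"
  assumes fin: "finite J" and conv: "\<And>j. j \<in> J \<Longrightarrow> convex (G j)" and sub: "\<And>j. j \<in> J \<Longrightarrow> G j \<subseteq> A"
    and dim: "\<And>Z. finite Z \<Longrightarrow> Z \<subseteq> A \<Longrightarrow> k < card Z \<Longrightarrow> affine_dependent Z" and k: "1 \<le> k"
    and empty: "(\<Inter>j\<in>J. G j) = {}"
  shows "\<exists>J'\<subseteq>J. card J' \<le> k \<and> (\<Inter>j\<in>J'. G j) = {}"
proof -
  obtain J' where J': "J' \<subseteq> J" "(\<Inter>j\<in>J'. G j) = {}"
    and minimal: "\<And>L. L \<subseteq> J \<Longrightarrow> (\<Inter>j\<in>L. G j) = {} \<Longrightarrow> card J' \<le> card L"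
    using ex_has_least_nat[of "\<lambda>L. L \<subseteq> J \<and> (\<Inter>j\<in>L. G j) = {}" J card] empty by auto
  have finJ': "finite J'" using J' fin finite_subset by auto
  have "card J' \<le> k"
  proof (rule ccontr)
    assume big: "\<not> card J' \<le> k"
    have "\<exists>z. \<forall>i\<in>J' - {j}. z \<in> G i" if "j \<in> J'" for j
    proof (rule ccontr)
      assume "\<nexists>z. \<forall>i\<in>J' - {j}. z \<in> G i"
      hence "(\<Inter>i\<in>J'-{j}. G i) = {}" by blast
      hence "card J' \<le> card (J' - {j})" using J' by (intro minimal) auto
      thus False using card_Diff1_less[OF finJ' that] by simp
    qed
    then obtain z where z: "\<And>j i. j \<in> J' \<Longrightarrow> i \<in> J' \<Longrightarrow> i \<noteq> j \<Longrightarrow> z j \<in> G i" 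
      by (metis Diff_iff singletonD)
    have "z ` J' \<subseteq> A"
    proof clarify
      fix j assume j: "j \<in> J'"
      have "J' - {j} \<noteq> {}"
      proof
        assume "J' - {j} = {}"
        hence "card J' \<le> card {j}" by (intro card_mono) auto
        thus False using big k by simp
      qed
      then obtain i where "i \<in> J'" "i \<noteq> j" by auto
      thus "z j \<in> A" using z[OF j] sub J' by blast
    qed
    have "\<exists>x. \<forall>j\<in>J'. x \<in> G j"
    proof (cases "inj_on z J'")
      case False
      then obtain i j where ij: "i \<in> J'" "j \<in> J'" "i \<noteq> j" "z i = z j" by (auto simp: inj_on_def)
      hence "z i \<in> G l" if "l \<in> J'" for l using z[of i l] z[of j i] that by (cases "l = i") auto
      thus ?thesis by blast
    next
      case True
      have "affine_dependent (z ` J')" using dim[of "z ` J'"] \<open>z ` J' \<subseteq> A\<close> big finJ' by (simp add: card_image[OF True])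
      then obtain M P where MP: "M \<inter> P = {}" "M \<union> P = z ` J'" "convex hull M \<inter> convex hull P \<noteq> {}"
        using Radon_partition[of "z ` J'"] finJ' by auto
      then obtain x where x: "x \<in> convex hull M" "x \<in> convex hull P" by blast
      have hullsub: "convex hull U \<subseteq> G j" if "j \<in> J'" "U \<subseteq> z ` J'" "z j \<notin> U" for U j
      proof (rule hull_minimal)
        show "U \<subseteq> G j" using that z by blast
        show "convex (G j)" using conv that J' by auto
      qed
      have "x \<in> G j" if j: "j \<in> J'" for j
      proof (cases "z j \<in> M")
        case True
        thus ?thesis using hullsub[of j P] j MP x by blast
      next
        case False
        thus ?thesis using hullsub[of j M] j MP x by blast
      qed
      thus ?thesis by blast
    qed
    thus False using J' by blast
  qed
  thus ?thesis using J' by blast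
qed

text \<open>
  Intersecting subfamilies collapse in the order of the minimum of \<open>Q\<close> on their intersections. Let \<open>p S\<close>
  be the minimizer for \<open>S\<close>. The convex set \<open>{Q < Q (p S)}\<close> misses the intersection of \<open>S\<close>, so by Helly's
  theorem it already misses the intersection of some \<open>\<sigma> \<subseteq> S\<close> with fewer than \<open>k\<close> members. A family \<open>T\<close> above \<open>\<sigma>\<close>
  thus has a minimum at least as large, and by strict convexity equality forces \<open>p T = p S\<close>, which puts
  \<open>T\<close> into the family \<open>\<tau>\<close> of all sets that contain \<open>p S\<close>.
\<close>
lemma nerve_collapse_by_minimal_points:
  fixes P :: "'i \<Rightarrow> 'a :: {real_vector, t2_space} set" and Q :: "'a \<Rightarrow> real"
  assumes fin: "finite I" and comp: "\<And>i. i \<in> I \<Longrightarrow> compact (P i)"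
    and conv: "\<And>i. i \<in> I \<Longrightarrow> convex (P i)" and sub: "\<And>i. i \<in> I \<Longrightarrow> P i \<subseteq> A"
    and A: "convex A"
    and dim: "\<And>Z. finite Z \<Longrightarrow> Z \<subseteq> A \<Longrightarrow> k < card Z \<Longrightarrow> affine_dependent Z" and k: "1 \<le> k"
    and cont: "continuous_on UNIV Q"
    and strict: "\<And>x y. x \<in> A \<Longrightarrow> y \<in> A \<Longrightarrow> x \<noteq> y \<Longrightarrow> Q x = Q y \<Longrightarrow> Q ((1/2) *\<^sub>R x + (1/2) *\<^sub>R y) < Q x"
    and sublevel: "\<And>r. convex {x\<in>A. Q x < r}"
  obtains f :: "'i set \<Rightarrow> real" where
    "\<And>S. S \<subseteq> I \<Longrightarrow> S \<noteq> {} \<Longrightarrow> (\<Inter>i\<in>S. P i) \<noteq> {} \<Longrightarrow>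
      \<exists>\<sigma> \<tau>. \<sigma> \<subseteq> S \<and> card \<sigma> < k \<and> \<tau> \<subseteq> I \<and> (\<Inter>i\<in>\<tau>. P i) \<noteq> {} \<and>
        (\<forall>T\<subseteq>I. (\<Inter>i\<in>T. P i) \<noteq> {} \<longrightarrow> \<sigma> \<subseteq> T \<longrightarrow> \<not> T \<subseteq> \<tau> \<longrightarrow> f S < f T)"
proof -
  have "\<exists>x. x \<in> (\<Inter>i\<in>S. P i) \<and> (\<forall>y\<in>(\<Inter>i\<in>S. P i). Q x \<le> Q y)"
    if S: "S \<subseteq> I" "S \<noteq> {}" "(\<Inter>i\<in>S. P i) \<noteq> {}" for S
  proof -
    obtain i0 where i0: "i0 \<in> S" using S by auto
    have "compact (P i0 \<inter> (\<Inter>i\<in>S. P i))"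
      using S i0 comp by (intro compact_Int_closed closed_INT) (auto intro: compact_imp_closed)
    also have "P i0 \<inter> (\<Inter>i\<in>S. P i) = (\<Inter>i\<in>S. P i)" using i0 by auto
    finally show ?thesis using continuous_attains_inf[OF _ S(3) continuous_on_subset[OF cont]] by blast
  qed
  hence "\<forall>S. \<exists>x. S \<subseteq> I \<longrightarrow> S \<noteq> {} \<longrightarrow> (\<Inter>i\<in>S. P i) \<noteq> {} \<longrightarrow>
      x \<in> (\<Inter>i\<in>S. P i) \<and> (\<forall>y\<in>(\<Inter>i\<in>S. P i). Q x \<le> Q y)" by simp
  from choice[OF this] obtain p where p_all: "\<forall>S. S \<subseteq> I \<longrightarrow> S \<noteq> {} \<longrightarrow> (\<Inter>i\<in>S. P i) \<noteq> {} \<longrightarrow>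
      p S \<in> (\<Inter>i\<in>S. P i) \<and> (\<forall>y\<in>(\<Inter>i\<in>S. P i). Q (p S) \<le> Q y)" by (elim exE)
  have p: "p S \<in> P i" if "S \<subseteq> I" "S \<noteq> {}" "(\<Inter>i\<in>S. P i) \<noteq> {}" "i \<in> S" for S i
    using p_all[rule_format, OF that(1-3)] that(4) by simp
  have pmin: "Q (p S) \<le> Q y" if "S \<subseteq> I" "S \<noteq> {}" "(\<Inter>i\<in>S. P i) \<noteq> {}" "\<forall>i\<in>S. y \<in> P i" for S y
    using p_all[rule_format, OF that(1-3)] that(4) by simp
  show thesis
  proof (rule that[of "\<lambda>S. Q (p S)"])
    fix S assume S: "S \<subseteq> I" "S \<noteq> {}" "(\<Inter>i\<in>S. P i) \<noteq> {}"
    define B where "B = {x\<in>A. Q x < Q (p S)}"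
    define G where "G = case_option B P"
    have G: "G None = B" "G (Some i) = P i" for i by (auto simp: G_def)
    have "(\<Inter>j\<in>insert None (Some ` S). G j) = {}"
      using pmin[OF S] by (fastforce simp: G B_def)
    moreover have "finite (insert None (Some ` S))" using S fin finite_subset by auto
    moreover have "convex (G j)" "G j \<subseteq> A" if "j \<in> insert None (Some ` S)" for j
      using that S(1) conv sub[THEN subsetD] sublevel[of "Q (p S)"] by (auto simp: G B_def)
    ultimately obtain J' where J': "J' \<subseteq> insert None (Some ` S)" "card J' \<le> k" "(\<Inter>j\<in>J'. G j) = {}"
      using helly_affine_dependent[of "insert None (Some ` S)" G A k] dim k by auto
    define \<sigma> where "\<sigma> = {i. Some i \<in> J'}"
    have "None \<in> J'"
    proof (rule ccontr)
      assume "None \<notin> J'"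
      have "p S \<in> G j" if "j \<in> J'" for j
      proof -
        from that J'(1) \<open>None \<notin> J'\<close> obtain i where "j = Some i" "i \<in> S" by blast
        thus ?thesis using p[OF S] by (simp add: G)
      qed
      thus False using J'(3) by blast
    qed
    have J'_eq: "J' = insert None (Some ` \<sigma>)"
    proof (intro equalityI subsetI)
      fix j assume "j \<in> J'" thus "j \<in> insert None (Some ` \<sigma>)" by (cases j) (auto simp: \<sigma>_def)
    qed (use \<open>None \<in> J'\<close> in \<open>auto simp: \<sigma>_def\<close>)
    have sS: "\<sigma> \<subseteq> S" using J' by (auto simp: \<sigma>_def)
    have "finite \<sigma>" using finite_subset[OF sS finite_subset[OF S(1) fin]] .
    hence cs: "card \<sigma> < k" using J'(2) by (simp add: J'_eq card_image)
    have inB: "x \<notin> B" if "\<forall>i\<in>\<sigma>. x \<in> P i" for x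
      using J'(3) that by (auto simp: J'_eq G)
    define \<tau> where "\<tau> = {i\<in>I. p S \<in> P i}"
    have pA: "p T \<in> A" if "T \<subseteq> I" "T \<noteq> {}" "(\<Inter>i\<in>T. P i) \<noteq> {}" for T
      using p[OF that] that sub by blast
    have "Q (p S) < Q (p T)" if T: "T \<subseteq> I" "(\<Inter>i\<in>T. P i) \<noteq> {}" "\<sigma> \<subseteq> T" "\<not> T \<subseteq> \<tau>" for T
    proof (rule ccontr)
      assume "\<not> Q (p S) < Q (p T)"
      have "T \<noteq> {}" using T by auto
      note pT = p[OF T(1) this T(2)] and TA = pA[OF T(1) this T(2)]
      have "p T \<notin> B" using pT T(3) by (intro inB) auto
      hence eq: "Q (p S) = Q (p T)" using TA \<open>\<not> Q (p S) < Q (p T)\<close> by (auto simp: B_def)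
      have ne: "p S \<noteq> p T" using pT T by (auto simp: \<tau>_def)
      define mid where "mid = (1/2) *\<^sub>R p S + (1/2) *\<^sub>R p T"
      have "mid \<in> A" using A pA[OF S] TA unfolding mid_def by (intro convexD) auto
      moreover have "Q mid < Q (p S)" unfolding mid_def using strict[OF pA[OF S] TA ne eq] .
      ultimately have "mid \<in> B" by (simp add: B_def)
      moreover have "\<forall>i\<in>\<sigma>. mid \<in> P i"
      proof
        fix i assume i: "i \<in> \<sigma>"
        show "mid \<in> P i" unfolding mid_def
          using conv[of i] p[OF S, of i] pT[of i] i sS T S by (intro convexD) auto
      qed
      ultimately show False using inB by blast
    qed
    moreover have "(\<Inter>i\<in>\<tau>. P i) \<noteq> {}" by (auto simp: \<tau>_def)
    moreover have "\<tau> \<subseteq> I" by (auto simp: \<tau>_def)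
    ultimately show "\<exists>\<sigma> \<tau>. \<sigma> \<subseteq> S \<and> card \<sigma> < k \<and> \<tau> \<subseteq> I \<and> (\<Inter>i\<in>\<tau>. P i) \<noteq> {} \<and>
        (\<forall>T\<subseteq>I. (\<Inter>i\<in>T. P i) \<noteq> {} \<longrightarrow> \<sigma> \<subseteq> T \<longrightarrow> \<not> T \<subseteq> \<tau> \<longrightarrow> Q (p S) < Q (p T))"
      using sS cs by blast
  qed
qed

text \<open>
  Minimizers need compactness, so each \<open>C i\<close> is first replaced by the convex hull \<open>P i\<close> of finitely many of
  its points, one chosen point for each intersecting subfamily that contains \<open>i\<close>; this changes no
  intersection pattern.
\<close>
lemma missing_subfamilies_lower_bound:
  fixes C :: "'i \<Rightarrow> 'a :: {real_vector, t2_space} set" and Q :: "'a \<Rightarrow> real"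
  assumes fin: "finite I" 
    and conv: "\<And>i. i \<in> I \<Longrightarrow> convex (C i)" and sub: "\<And>i. i \<in> I \<Longrightarrow> C i \<subseteq> A"
    and A: "convex A"
    and dim: "\<And>Z. finite Z \<Longrightarrow> Z \<subseteq> A \<Longrightarrow> k < card Z \<Longrightarrow> affine_dependent Z" and k: "1 \<le> k" "k \<le> card I"
    and polytope: "\<And>Z :: 'a set. finite Z \<Longrightarrow> compact (convex hull Z)"
    and cont: "continuous_on UNIV Q"
    and strict: "\<And>x y. x \<in> A \<Longrightarrow> y \<in> A \<Longrightarrow> x \<noteq> y \<Longrightarrow> Q x = Q y \<Longrightarrow> Q ((1/2) *\<^sub>R x + (1/2) *\<^sub>R y) < Q x"
    and sublevel: "\<And>r. convex {x\<in>A. Q x < r}"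
    and m: "\<And>S. S \<subseteq> I \<Longrightarrow> (\<Inter>i\<in>S. C i) \<noteq> {} \<Longrightarrow> card S \<le> m"
  shows "real (card I - m) ^ k * real (card I choose k)
    \<le> real (card I) ^ k * real (card {S. S \<subseteq> I \<and> card S = k \<and> (\<Inter>i\<in>S. C i) = {}})"
proof -
  define q where "q = (\<lambda>S. SOME x. x \<in> (\<Inter>i\<in>S. C i))"
  have q: "q S \<in> C i" if "(\<Inter>i\<in>S. C i) \<noteq> {}" "i \<in> S" for S i
  proof -
    have "q S \<in> (\<Inter>i\<in>S. C i)" unfolding q_def using that(1) by (intro someI_ex[of "\<lambda>x. x \<in> (\<Inter>i\<in>S. C i)"]) blast
    thus ?thesis using that by blast
  qed
  define P where "P = (\<lambda>i. convex hull (q ` {S. S \<subseteq> I \<and> i \<in> S \<and> (\<Inter>i\<in>S. C i) \<noteq> {}}))"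
  have "finite {S. S \<subseteq> I \<and> i \<in> S \<and> (\<Inter>i\<in>S. C i) \<noteq> {}}" for i
    using fin by (auto intro: finite_subset[of _ "Pow I"])
  hence Pcomp: "compact (P i)" for i unfolding P_def by (intro polytope) auto
  have Pconv: "convex (P i)" for i by (simp add: P_def)
  have PC: "P i \<subseteq> C i" if "i \<in> I" for i
    unfolding P_def by (rule hull_minimal) (use q conv that in auto)
  have nerve: "(\<Inter>i\<in>S. P i) \<noteq> {} \<longleftrightarrow> (\<Inter>i\<in>S. C i) \<noteq> {}" if S: "S \<subseteq> I" for S
  proof
    assume "(\<Inter>i\<in>S. P i) \<noteq> {}"
    thus "(\<Inter>i\<in>S. C i) \<noteq> {}" using PC S by blast
  next
    assume ne: "(\<Inter>i\<in>S. C i) \<noteq> {}"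
    have "q S \<in> P i" if "i \<in> S" for i
      unfolding P_def by (rule hull_inc) (use ne that S in auto)
    thus "(\<Inter>i\<in>S. P i) \<noteq> {}" by blast
  qed
  obtain f where f: "\<And>S. S \<subseteq> I \<Longrightarrow> S \<noteq> {} \<Longrightarrow> (\<Inter>i\<in>S. P i) \<noteq> {} \<Longrightarrow>
      \<exists>\<sigma> \<tau>. \<sigma> \<subseteq> S \<and> card \<sigma> < k \<and> \<tau> \<subseteq> I \<and> (\<Inter>i\<in>\<tau>. P i) \<noteq> {} \<and>
        (\<forall>T\<subseteq>I. (\<Inter>i\<in>T. P i) \<noteq> {} \<longrightarrow> \<sigma> \<subseteq> T \<longrightarrow> \<not> T \<subseteq> \<tau> \<longrightarrow> f S < (f T :: real))"
  proof (rule nerve_collapse_by_minimal_points[of I P A k Q])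
    show "P i \<subseteq> A" if "i \<in> I" for i using PC[OF that] sub[OF that] by blast
  qed (use fin Pcomp Pconv A dim k cont strict sublevel in auto)
  define N where "N = {S. (\<Inter>i\<in>S. P i) \<noteq> {}}"
  have "(card I - m) ^ k \<le> card {t. set t \<subseteq> I \<and> length t = k \<and> set t \<notin> N}"
  proof (rule tuples_outside_collapsible_complex[OF fin k(1), of N m f])
    fix S assume S: "S \<in> N" "S \<subseteq> I" "S \<noteq> {}"
    have ne: "(\<Inter>i\<in>S. P i) \<noteq> {}" using S(1) by (simp add: N_def)
    obtain \<sigma> \<tau> where *: "\<sigma> \<subseteq> S \<and> card \<sigma> < k \<and> \<tau> \<subseteq> I \<and> (\<Inter>i\<in>\<tau>. P i) \<noteq> {} \<and>
        (\<forall>T\<subseteq>I. (\<Inter>i\<in>T. P i) \<noteq> {} \<longrightarrow> \<sigma> \<subseteq> T \<longrightarrow> \<not> T \<subseteq> \<tau> \<longrightarrow> f S < f T)"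
      using f[OF S(2,3) ne] by (elim exE)
    hence t: "\<tau> \<subseteq> I" "(\<Inter>i\<in>\<tau>. P i) \<noteq> {}" by simp_all
    have "card \<tau> \<le> m" using m[OF t(1)] nerve[OF t(1)] t(2) by simp
    hence "\<sigma> \<subseteq> S \<and> card \<sigma> < k \<and> \<tau> \<subseteq> I \<and> card \<tau> \<le> m \<and>
      (\<forall>T\<in>N. T \<subseteq> I \<longrightarrow> \<sigma> \<subseteq> T \<longrightarrow> \<not> T \<subseteq> \<tau> \<longrightarrow> f S < f T)"
      using * by (simp add: N_def)
    thus "\<exists>\<sigma> \<tau>. \<sigma> \<subseteq> S \<and> card \<sigma> < k \<and> \<tau> \<subseteq> I \<and> card \<tau> \<le> m \<and>
      (\<forall>T\<in>N. T \<subseteq> I \<longrightarrow> \<sigma> \<subseteq> T \<longrightarrow> \<not> T \<subseteq> \<tau> \<longrightarrow> f S < f T)"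
      by (rule exI[of _ \<tau>, THEN exI[of _ \<sigma>]])
  qed
  hence "real (card I - m) ^ k \<le> real (card {t. set t \<subseteq> I \<and> length t = k \<and> set t \<notin> N})"
    unfolding of_nat_power[symmetric] of_nat_le_iff .
  hence "real (card I - m) ^ k * real (card I choose k)
     \<le> real (card {t. set t \<subseteq> I \<and> length t = k \<and> set t \<notin> N}) * real (card I choose k)"
    by (intro mult_right_mono) auto
  also have "\<dots> \<le> real (card I) ^ k * real (card {S. S \<subseteq> I \<and> card S = k \<and> S \<notin> N})"
    by (rule missing_tuples_le_missing_subsets[OF fin k(2)]) (auto simp: N_def)
  also have "{S. S \<subseteq> I \<and> card S = k \<and> S \<notin> N} = {S. S \<subseteq> I \<and> card S = k \<and> (\<Inter>i\<in>S. C i) = {}}"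
    using nerve by (auto simp: N_def)
  finally show ?thesis .
qed

text \<open>
  The count above reads \<open>(1 - m/n)\<^sup>k \<le> 1 - a\<close>, where \<open>m\<close> is the largest size of an intersecting
  subfamily; solving for \<open>m\<close> gives the bound.
\<close>

lemma fractional_helly:
  fixes C :: "'i \<Rightarrow> 'a :: {real_vector, t2_space} set" and Q :: "'a \<Rightarrow> real"
  assumes fin: "finite I" 
    and conv: "\<And>i. i \<in> I \<Longrightarrow> convex (C i)" and sub: "\<And>i. i \<in> I \<Longrightarrow> C i \<subseteq> A"
    and A: "convex A"
    and dim: "\<And>Z. finite Z \<Longrightarrow> Z \<subseteq> A \<Longrightarrow> k < card Z \<Longrightarrow> affine_dependent Z" and k: "1 \<le> k" "k \<le> card I"
    and polytope: "\<And>Z :: 'a set. finite Z \<Longrightarrow> compact (convex hull Z)"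
    and cont: "continuous_on UNIV Q"
    and strict: "\<And>x y. x \<in> A \<Longrightarrow> y \<in> A \<Longrightarrow> x \<noteq> y \<Longrightarrow> Q x = Q y \<Longrightarrow> Q ((1/2) *\<^sub>R x + (1/2) *\<^sub>R y) < Q x"
    and sublevel: "\<And>r. convex {x\<in>A. Q x < r}"
    and many: "a * real (card I choose k) \<le> real (card {S. S \<subseteq> I \<and> card S = k \<and> (\<Inter>i\<in>S. C i) \<noteq> {}})"
  shows "\<exists>S\<subseteq>I. (\<Inter>i\<in>S. C i) \<noteq> {} \<and> (1 - (1 - a) powr (1 / real k)) * real (card I) \<le> real (card S)"
proof -
  define n where "n = card I"
  define cards where "cards = card ` {S. S \<subseteq> I \<and> (\<Inter>i\<in>S. C i) \<noteq> {}}"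
  have fc: "finite cards" "cards \<noteq> {}" unfolding cards_def
    using fin by (auto intro!: exI[of _ "{}"] intro: finite_subset[of _ "Pow I"])
  define m where "m = Max cards"
  have "m \<in> cards" unfolding m_def by (rule Max_in[OF fc])
  then obtain S where S: "S \<subseteq> I" "(\<Inter>i\<in>S. C i) \<noteq> {}" "card S = m" by (auto simp: cards_def)
  have max: "card T \<le> m" if "T \<subseteq> I" "(\<Inter>i\<in>T. C i) \<noteq> {}" for T
    unfolding m_def by (rule Max_ge[OF fc(1)]) (use that in \<open>auto simp: cards_def\<close>)
  have mn: "m \<le> n" using S fin card_mono unfolding n_def by metis
  have n: "n > 0" using k by (simp add: n_def)
  have ch: "real (n choose k) > 0" using k by (simp add: n_def)
  define Y where "Y = {S. S \<subseteq> I \<and> card S = k \<and> (\<Inter>i\<in>S. C i) \<noteq> {}}"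
  define M where "M = {S. S \<subseteq> I \<and> card S = k \<and> (\<Inter>i\<in>S. C i) = {}}"
  have fYM: "finite Y" "finite M" using fin by (auto simp: Y_def M_def intro: finite_subset[of _ "Pow I"])
  have "Y \<union> M = {S. S \<subseteq> I \<and> card S = k}" by (auto simp: Y_def M_def)
  hence "n choose k = card (Y \<union> M)" using n_subsets[OF fin, of k] by (simp add: n_def)
  also have "\<dots> = card Y + card M" by (intro card_Un_disjoint fYM) (auto simp: Y_def M_def)
  finally have "real (card M) = real (n choose k) - real (card Y)" by simp
  also have "\<dots> \<le> (1 - a) * real (n choose k)" using many unfolding Y_def n_def by (simp add: algebra_simps)
  finally have cM: "real (card M) \<le> (1 - a) * real (n choose k)" .
  have "real (n - m) ^ k * real (n choose k) \<le> real n ^ k * real (card M)"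
    unfolding n_def M_def
    by (rule missing_subfamilies_lower_bound[of I C A k Q m]) (use assms max in auto)
  also have "\<dots> \<le> real n ^ k * ((1 - a) * real (n choose k))" using cM by (intro mult_left_mono) auto
  finally have "real (n - m) ^ k \<le> real n ^ k * (1 - a)" using ch by simp
  hence le: "(real (n - m) / real n) ^ k \<le> 1 - a" using n by (simp add: power_divide divide_le_eq mult.commute)
  have root: "r = (r ^ k) powr (1 / real k)" if "r > 0" for r :: real
    using that k by (simp add: powr_realpow[symmetric] powr_powr)
  have "real (n - m) / real n = ((real (n - m) / real n) ^ k) powr (1 / real k)"
  proof (cases "n = m")
    case False
    hence "real (n - m) / real n > 0" using mn n by simp
    thus ?thesis by (rule root)
  qed (use k in simp)
  also have "\<dots> \<le> (1 - a) powr (1 / real k)" using le by (intro powr_mono2) auto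
  finally have "real n - real m \<le> (1 - a) powr (1 / real k) * real n" using n mn by (simp add: divide_le_eq of_nat_diff)
  hence "(1 - (1 - a) powr (1 / real k)) * real n \<le> real m" by (simp add: algebra_simps)
  thus ?thesis using S unfolding n_def by blast
qed

section \<open>Random directions\<close>

text \<open>
  The mean \<open>a\<close> is a parameter because the probability of a rare event under the centred measure is
  estimated through a shifted one.
\<close>

definition gaussian :: "nat \<Rightarrow> (nat \<Rightarrow> real) \<Rightarrow> (nat \<Rightarrow> real) measure" where
  "gaussian d a = (\<Pi>\<^sub>M i\<in>{..<d}. density lborel (normal_density (a i) 1))"

lemma sets_gaussian [measurable_cong]: "sets (gaussian d a) = sets (\<Pi>\<^sub>M i\<in>{..<d}. borel)"
  unfolding gaussian_def by (intro sets_PiM_cong) auto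

lemma space_gaussian: "space (gaussian d a) = extensional {..<d}"
  by (simp add: gaussian_def space_PiM PiE_UNIV_domain PiE_def)

lemma prob_space_gaussian: "prob_space (gaussian d a)"
  unfolding gaussian_def by (intro prob_space_PiM prob_space_normal_density) auto

lemma distributed_gaussian_coordinate:
  assumes "i < d"
  shows "distributed (gaussian d a) lborel (\<lambda>g. g i) (normal_density (a i) 1)"
proof -
  have "distr (gaussian d a) lborel (\<lambda>g. g i) = distr (gaussian d a) (density lborel (normal_density (a i) 1)) (\<lambda>g. g i)"
    by (intro distr_cong) auto
  also have "\<dots> = density lborel (normal_density (a i) 1)"
    unfolding gaussian_def using assms
    by (intro distr_PiM_component) (auto intro: prob_space_normal_density)
  finally show ?thesis using assms by (auto simp: distributed_def)
qed

lemma indep_gaussian_coordinates: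
  assumes "I \<subseteq> {..<d}"
  shows "prob_space.indep_vars (gaussian d a) (\<lambda>_. borel) (\<lambda>i g. g i) I"
proof (cases "{..<d} = {}")
  interpret prob_space "gaussian d a" by (rule prob_space_gaussian)
  case False
  let ?M = "\<lambda>i. density lborel (normal_density (a i) 1)"
  have "distr (gaussian d a) (\<Pi>\<^sub>M i\<in>{..<d}. borel) (\<lambda>g. \<lambda>i\<in>{..<d}. g i) = distr (gaussian d a) (gaussian d a) (\<lambda>g. g)"
    by (intro distr_cong) (auto simp: sets_gaussian space_gaussian extensional_restrict)
  also have "\<dots> = gaussian d a" by (rule distr_id)
  also have "\<dots> = (\<Pi>\<^sub>M i\<in>{..<d}. distr (gaussian d a) borel (\<lambda>g. g i))"
    unfolding gaussian_def[of d a]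
  proof (intro PiM_cong refl)
    fix i assume "i \<in> {..<d}"
    hence "distr (gaussian d a) lborel (\<lambda>g. g i) = ?M i"
      using distributed_gaussian_coordinate[of i d a] by (auto simp: distributed_def)
    moreover have "distr (gaussian d a) lborel (\<lambda>g. g i) = distr (gaussian d a) borel (\<lambda>g. g i)"
      by (intro distr_cong) auto
    ultimately show "?M i = distr (Pi\<^sub>M {..<d} ?M) borel (\<lambda>g. g i)" by (simp add: gaussian_def)
  qed
  finally have "indep_vars (\<lambda>_. borel) (\<lambda>i g. g i) {..<d}"
    using False by (subst indep_vars_iff_distr_eq_PiM') auto
  thus ?thesis using assms by (rule indep_vars_subset)
next
  interpret prob_space "gaussian d a" by (rule prob_space_gaussian)
  case True
  thus ?thesis using assms by (auto simp: indep_vars_def indep_sets_def)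
qed

text \<open>
  Only the nonzero coefficients of \<open>u\<close> contribute proper normal variables, so the sum is restricted to them.
\<close>
lemma distributed_gaussian_inner:
  assumes "(\<Sum>i<d. (u i)\<^sup>2) = 1"
  shows "distributed (gaussian d a) lborel (\<lambda>g. \<Sum>i<d. u i * g i) (normal_density (\<Sum>i<d. u i * a i) 1)"
proof -
  interpret prob_space "gaussian d a" by (rule prob_space_gaussian)
  define I where "I = {i. i < d \<and> u i \<noteq> 0}"
  have I: "finite I" "I \<subseteq> {..<d}" by (auto simp: I_def)
  have restr: "(\<Sum>i\<in>I. h i) = (\<Sum>i<d. h i)" if "\<And>i. u i = 0 \<Longrightarrow> h i = 0" for h :: "nat \<Rightarrow> real"
    using that by (intro sum.mono_neutral_left) (auto simp: I_def)
  have ne: "I \<noteq> {}"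
    using restr[of "\<lambda>i. (u i)\<^sup>2"] assms by auto
  have ind: "indep_vars (\<lambda>_. borel) (\<lambda>i g. u i * g i) I"
    using indep_vars_compose2[OF indep_gaussian_coordinates[OF I(2), of a], of "\<lambda>i x. u i * x" "\<lambda>_. borel"] by simp
  have distri: "distributed (gaussian d a) lborel (\<lambda>g. u i * g i) (normal_density (u i * a i) \<bar>u i\<bar>)" if "i \<in> I" for i
    using normal_density_affine[OF distributed_gaussian_coordinate[of i d a], of "u i" 0] that by (simp add: I_def mult.commute)
  have "distributed (gaussian d a) lborel (\<lambda>g. \<Sum>i\<in>I. u i * g i) 
     (normal_density (\<Sum>i\<in>I. u i * a i) (sqrt (\<Sum>i\<in>I. \<bar>u i\<bar>\<^sup>2)))"
    by (rule sum_indep_normal[OF I(1) ne ind _ distri]) (auto simp: I_def)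
  thus ?thesis using assms restr[of "\<lambda>i. (u i)\<^sup>2"] restr[of "\<lambda>i. u i * a i"] restr[of "\<lambda>i. u i * g i" for g]
    by simp
qed

lemma gaussian_norm_tail:
  assumes "K > 0" "d > 0"
  shows "measure (gaussian d a) {g \<in> space (gaussian d a). K * real d \<le> (\<Sum>i<d. (g i - a i)\<^sup>2)} \<le> 1 / K"
proof -
  interpret prob_space "gaussian d a" by (rule prob_space_gaussian)
  have var: "expectation (\<lambda>g. (g i - a i)\<^sup>2) = 1" "integrable (gaussian d a) (\<lambda>g. (g i - a i)\<^sup>2)" if "i < d" for i
  proof -
    note D = distributed_gaussian_coordinate[OF that, of a]
    show "expectation (\<lambda>g. (g i - a i)\<^sup>2) = 1"
      using normal_distributed_variance[OF _ D] normal_distributed_expectation[OF _ D] by simp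
    thus "integrable (gaussian d a) (\<lambda>g. (g i - a i)\<^sup>2)" using not_integrable_integral_eq by fastforce
  qed
  have "measure (gaussian d a) {g \<in> space (gaussian d a). K * real d \<le> (\<Sum>i<d. (g i - a i)\<^sup>2)}
     \<le> (\<integral>g. (\<Sum>i<d. (g i - a i)\<^sup>2) \<partial>gaussian d a) / (K * real d)"
    using assms var by (intro integral_Markov_inequality_measure[where A = "{}"]) (auto intro!: sum_nonneg)
  also have "(\<integral>g. (\<Sum>i<d. (g i - a i)\<^sup>2) \<partial>gaussian d a) = real d"
    using var by (subst Bochner_Integration.integral_sum) auto
  finally show ?thesis using assms by simp
qed

lemma gaussian_inner_tail:
  assumes "(\<Sum>i<d. (u i)\<^sup>2) = 1" "t > 0"
  shows "measure (gaussian d a) {g \<in> space (gaussian d a). t \<le> \<bar>\<Sum>i<d. u i * (g i - a i)\<bar>} \<le> 1 / t\<^sup>2"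
proof -
  interpret prob_space "gaussian d a" by (rule prob_space_gaussian)
  note D = distributed_gaussian_inner[OF assms(1), of a]
  let ?X = "\<lambda>g. \<Sum>i<d. u i * g i"
  have rv: "random_variable borel ?X" by measurable
  have E: "expectation ?X = (\<Sum>i<d. u i * a i)" and V: "variance ?X = 1"
    using normal_distributed_variance[OF _ D] normal_distributed_expectation[OF _ D] by simp_all
  have "integrable (gaussian d a) (\<lambda>g. (?X g - expectation ?X)\<^sup>2)" using V not_integrable_integral_eq by fastforce
  hence "prob {g \<in> space (gaussian d a). t \<le> \<bar>?X g - expectation ?X\<bar>} \<le> variance ?X / t\<^sup>2"
    using assms by (intro second_moment_method) auto
  thus ?thesis unfolding V unfolding E by (simp add: right_diff_distrib sum_subtractf)
qed

text \<open>
  The normal density is below \<open>1/2\<close>, and the interval has length \<open>2r\<close>.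
\<close>
lemma gaussian_inner_small_ball:
  assumes "(\<Sum>i<d. (u i)\<^sup>2) = 1" "r > 0"
  shows "measure (gaussian d a) {g \<in> space (gaussian d a). \<bar>\<Sum>i<d. u i * g i\<bar> < r} \<le> r"
proof -
  interpret prob_space "gaussian d a" by (rule prob_space_gaussian)
  let ?X = "\<lambda>g. \<Sum>i<d. u i * g i"
  let ?\<mu> = "\<Sum>i<d. u i * a i"
  note D = distributed_gaussian_inner[OF assms(1), of a]
  have dens: "normal_density ?\<mu> 1 x \<le> 1/2" for x
  proof -
    have "2 \<le> sqrt (2 * pi)" using pi_gt3 by (intro real_le_rsqrt) auto
    hence "1 / sqrt (2 * pi) \<le> 1/2" by (simp add: field_simps)
    moreover have "exp (- (x - ?\<mu>)\<^sup>2 / 2) \<le> 1" by simp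
    ultimately have "1 / sqrt (2 * pi) * exp (- (x - ?\<mu>)\<^sup>2 / 2) \<le> 1/2 * 1" by (intro mult_mono) auto
    thus ?thesis by (simp add: normal_density_def)
  qed
  have "{g \<in> space (gaussian d a). \<bar>?X g\<bar> < r} = ?X -` {-r<..<r} \<inter> space (gaussian d a)" by auto
  hence "emeasure (gaussian d a) {g \<in> space (gaussian d a). \<bar>?X g\<bar> < r} = (\<integral>\<^sup>+x. ennreal (normal_density ?\<mu> 1 x) * indicator {-r<..<r} x \<partial>lborel)"
    using distributed_emeasure[OF D, of "{-r<..<r}"] by simp
  also have "\<dots> \<le> (\<integral>\<^sup>+x. ennreal (1/2) * indicator {-r<..<r} x \<partial>lborel)"
    by (intro nn_integral_mono mult_right_mono ennreal_leI dens) auto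
  also have "\<dots> = ennreal (1/2) * ennreal (2 * r)"
    using assms(2) by (simp add: nn_integral_cmult_indicator)
  also have "\<dots> = ennreal (1/2 * (2 * r))" using assms(2) by (intro ennreal_mult[symmetric]) auto
  finally show ?thesis using assms(2) by (simp add: emeasure_eq_measure)
qed

text \<open>
  The Cameron--Martin formula. It holds coordinatewise for the one-dimensional densities, and a
  product measure is determined by its values on boxes.
\<close>
lemma gaussian_shift:
  "gaussian d (\<lambda>_. 0) = density (gaussian d a) (\<lambda>g. ennreal (exp (\<Sum>i<d. (a i)\<^sup>2 / 2 - a i * g i)))"
proof -
  let ?M = "\<lambda>a. density lborel (normal_density a 1)"
  interpret A: product_sigma_finite "\<lambda>i. ?M (a i)"
    by (intro product_sigma_finite.intro prob_space_imp_sigma_finite prob_space_normal_density) auto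
  interpret Z: product_sigma_finite "\<lambda>i::nat. ?M 0"
    by (intro product_sigma_finite.intro prob_space_imp_sigma_finite prob_space_normal_density) auto
  have "density (gaussian d a) (\<lambda>g. ennreal (exp (\<Sum>i<d. (a i)\<^sup>2 / 2 - a i * g i))) = PiM {..<d} (\<lambda>i. ?M 0)"
  proof (rule Z.PiM_eqI)
    fix B assume "\<And>i. i \<in> {..<d} \<Longrightarrow> B i \<in> sets (?M 0)"
    hence B[measurable]: "B i \<in> sets borel" if "i < d" for i using that by simp
    have BP: "Pi\<^sub>E {..<d} B \<in> sets (gaussian d a)" unfolding sets_gaussian by (intro sets_PiM_I_finite) auto
    have "emeasure (density (gaussian d a) (\<lambda>g. ennreal (exp (\<Sum>i<d. (a i)\<^sup>2 / 2 - a i * g i)))) (Pi\<^sub>E {..<d} B)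
      = (\<integral>\<^sup>+g. ennreal (exp (\<Sum>i<d. (a i)\<^sup>2 / 2 - a i * g i)) * indicator (Pi\<^sub>E {..<d} B) g \<partial>gaussian d a)"
      using BP by (intro emeasure_density) measurable
    also have "\<dots> = (\<integral>\<^sup>+g. (\<Prod>i<d. ennreal (exp ((a i)\<^sup>2 / 2 - a i * g i)) * indicator (B i) (g i)) \<partial>gaussian d a)"
    proof (rule nn_integral_cong)
      fix g assume "g \<in> space (gaussian d a)"
      hence "g \<in> extensional {..<d}" by (auto simp: gaussian_def space_PiM PiE_def)
      hence "indicator (Pi\<^sub>E {..<d} B) g = (\<Prod>i<d. indicator (B i) (g i) :: ennreal)"
        by (auto simp: indicator_def PiE_def Pi_def prod_eq_1_iff intro!: prod_zero)
      thus "ennreal (exp (\<Sum>i<d. (a i)\<^sup>2 / 2 - a i * g i)) * indicator (Pi\<^sub>E {..<d} B) g =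
         (\<Prod>i<d. ennreal (exp ((a i)\<^sup>2 / 2 - a i * g i)) * indicator (B i) (g i))"
        by (simp add: exp_sum prod.distrib prod_ennreal)
    qed
    also have "\<dots> = (\<Prod>i<d. \<integral>\<^sup>+x. ennreal (exp ((a i)\<^sup>2 / 2 - a i * x)) * indicator (B i) x \<partial>?M (a i))"
      unfolding gaussian_def by (intro A.product_nn_integral_prod) auto
    also have "\<dots> = (\<Prod>i<d. emeasure (?M 0) (B i))"
    proof (intro prod.cong refl)
      fix i assume i: "i \<in> {..<d}"
      have "normal_density (a i) 1 x * exp ((a i)\<^sup>2 / 2 - a i * x) = std_normal_density x" for x
        by (simp add: normal_density_def power2_eq_square field_simps flip: exp_add)
      hence eq: "ennreal (normal_density (a i) 1 x) * (ennreal (exp ((a i)\<^sup>2 / 2 - a i * x)) * y) = ennreal (std_normal_density x) * y" for x y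
        by (simp add: mult.assoc[symmetric] flip: ennreal_mult)
      show "(\<integral>\<^sup>+x. ennreal (exp ((a i)\<^sup>2 / 2 - a i * x)) * indicator (B i) x \<partial>?M (a i)) = emeasure (?M 0) (B i)"
        using i by (simp add: nn_integral_density emeasure_density eq)
    qed
    finally show "emeasure (density (gaussian d a) (\<lambda>g. ennreal (exp (\<Sum>i<d. (a i)\<^sup>2 / 2 - a i * g i)))) (Pi\<^sub>E {..<d} B)
        = (\<Prod>i<d. emeasure (?M 0) (B i))" .
  qed (auto simp: sets_gaussian intro!: sets_PiM_cong)
  thus ?thesis by (simp add: gaussian_def)
qed

text \<open>
  The length of the shift in the direction \<open>u\<close>. The root is the value of \<open>\<langle>u, g\<rangle>\<close> that suffices for
  \<open>d \<langle>u, g\<rangle>\<^sup>2 \<ge> c\<^sup>2 \<bar>g\<bar>\<^sup>2\<close> when the deviation of \<open>g\<close> from its mean has squared norm below \<open>4d\<close>; the summand \<open>2\<close>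
  allows for two standard deviations.
\<close>
definition tilt :: "real \<Rightarrow> real" where
  "tilt c = 2 + sqrt (8 * c\<^sup>2 / (2 - c\<^sup>2))"

text \<open>
  The first bound tends to \<open>1\<close> at \<open>0\<close>, the second is positive on all of \<open>(0, sqrt 2)\<close>.
\<close>
definition dir_prob :: "real \<Rightarrow> real" where
  "dir_prob c = max (1 - sqrt c - c) (exp (- ((tilt c)\<^sup>2 / 2 + 2 * tilt c)) / 2)"

text \<open>
  Requiring a nonzero inner product excludes \<open>g = 0\<close>, which cannot be normalized. Points are extensional because
  they belong to the product measure over \<open>{..<d}\<close>.
\<close>
definition good_dirs :: "nat \<Rightarrow> real \<Rightarrow> (nat \<Rightarrow> real) \<Rightarrow> (nat \<Rightarrow> real) set" where
  "good_dirs d c u = {g \<in> extensional {..<d}. (\<Sum>i<d. u i * g i) \<noteq> 0 \<and>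
     c\<^sup>2 * (\<Sum>i<d. (g i)\<^sup>2) \<le> real d * (\<Sum>i<d. u i * g i)\<^sup>2}"

lemma good_dirs_measurable [measurable]: "good_dirs d c u \<in> sets (gaussian d a)"
proof -
  have gen: "{g \<in> space M. X g \<noteq> 0 \<and> c\<^sup>2 * Y g \<le> real d * (X g)\<^sup>2} \<in> sets M"
    if [measurable]: "X \<in> borel_measurable M" "Y \<in> borel_measurable M" for X Y :: "_ \<Rightarrow> real" and M
  proof -
    have "{g \<in> space M. 0 < \<bar>X g\<bar> \<and> c\<^sup>2 * Y g \<le> real d * (X g)\<^sup>2} \<in> sets M" by measurable
    thus ?thesis by simp
  qed
  have "{g \<in> space (gaussian d a). (\<Sum>i<d. u i * g i) \<noteq> 0 \<and>
     c\<^sup>2 * (\<Sum>i<d. (g i)\<^sup>2) \<le> real d * (\<Sum>i<d. u i * g i)\<^sup>2} \<in> sets (gaussian d a)"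
    by (rule gen) measurable
  thus ?thesis by (simp add: good_dirs_def space_gaussian)
qed

text \<open>
  A union bound: \<open>\<bar>g\<bar>\<^sup>2\<close> exceeds \<open>d / c\<close> with probability at most \<open>c\<close>, and \<open>\<bar>\<langle>u, g\<rangle>\<bar>\<close> is below \<open>sqrt c\<close> with
  probability at most \<open>sqrt c\<close>.
\<close>
lemma good_dirs_prob_small:
  assumes u: "(\<Sum>i<d. (u i)\<^sup>2) = 1" and c: "0 < c" and d: "0 < d"
  shows "1 - sqrt c - c \<le> measure (gaussian d (\<lambda>_. 0)) (good_dirs d c u)"
proof -
  let ?G = "gaussian d (\<lambda>_. 0)"
  interpret prob_space ?G by (rule prob_space_gaussian)
  define T1 where "T1 = {g \<in> space ?G. (1 / c) * real d \<le> (\<Sum>i<d. (g i)\<^sup>2)}"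
  define T2 where "T2 = {g \<in> space ?G. \<bar>\<Sum>i<d. u i * g i\<bar> < sqrt c}"
  have [measurable]: "T1 \<in> sets ?G" "T2 \<in> sets ?G" unfolding T1_def T2_def by measurable
  have T1: "prob T1 \<le> c" using gaussian_norm_tail[of "1/c" d "\<lambda>_. 0"] c d by (simp add: T1_def)
  have T2: "prob T2 \<le> sqrt c" using gaussian_inner_small_ball[OF u, of "sqrt c" "\<lambda>_. 0"] c by (simp add: T2_def)
  have "space ?G - (T1 \<union> T2) \<subseteq> good_dirs d c u"
  proof
    fix g assume g: "g \<in> space ?G - (T1 \<union> T2)"
    define X where "X = (\<Sum>i<d. u i * g i)"
    have 1: "(\<Sum>i<d. (g i)\<^sup>2) < (1 / c) * real d" and 2: "sqrt c \<le> \<bar>X\<bar>" using g by (auto simp: T1_def T2_def X_def)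
    have "(sqrt c)\<^sup>2 \<le> \<bar>X\<bar>\<^sup>2" using 2 c by (intro power_mono) auto
    hence X2: "c \<le> X\<^sup>2" using c by simp
    have "c\<^sup>2 * (\<Sum>i<d. (g i)\<^sup>2) \<le> c\<^sup>2 * ((1 / c) * real d)" using 1 by (intro mult_left_mono) auto
    also have "\<dots> = real d * c" using c by (simp add: power2_eq_square)
    also have "\<dots> \<le> real d * X\<^sup>2" using X2 by (intro mult_left_mono) auto
    finally show "g \<in> good_dirs d c u" using g X2 c by (auto simp: good_dirs_def space_gaussian X_def)
  qed
  hence "prob (space ?G - (T1 \<union> T2)) \<le> prob (good_dirs d c u)" by (intro finite_measure_mono) auto
  moreover have "prob (space ?G - (T1 \<union> T2)) = 1 - prob (T1 \<union> T2)" by (intro prob_compl) auto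
  moreover have "prob (T1 \<union> T2) \<le> prob T1 + prob T2" by (intro measure_Un_le) auto
  ultimately show ?thesis using T1 T2 by linarith
qed

text \<open>
  For \<open>c\<close> near \<open>sqrt 2\<close> a union bound fails, since \<open>\<langle>u, g\<rangle>\<close> has to be atypically large while the rest of \<open>g\<close>
  stays of moderate size. Shifting the mean to \<open>s u\<close> makes the required event typical, with
  probability at least \<open>1/2\<close>, and on that event the density with respect to the shifted measure is bounded below
  independently of \<open>d\<close>. The restriction \<open>d \<ge> 2\<close> enters through \<open>d - c\<^sup>2 \<ge> d (2 - c\<^sup>2) / 2\<close>.
\<close>
lemma good_dirs_prob_shift:
  assumes u: "(\<Sum>i<d. (u i)\<^sup>2) = 1" and c: "0 < c" "c < sqrt 2" and d: "2 \<le> d"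
  shows "exp (- ((tilt c)\<^sup>2 / 2 + 2 * tilt c)) / 2 \<le> measure (gaussian d (\<lambda>_. 0)) (good_dirs d c u)"
proof -
  define s where "s = tilt c"
  define a where "a = (\<lambda>i. s * u i)"
  let ?G = "gaussian d a"
  interpret prob_space ?G by (rule prob_space_gaussian)
  interpret Z: prob_space "gaussian d (\<lambda>_. 0)" by (rule prob_space_gaussian)
  have c2: "c\<^sup>2 < 2" using c real_sqrt_less_iff[of "c\<^sup>2" 2] by simp
  have c20: "c\<^sup>2 > 0" using c by simp
  define T1 where "T1 = {g \<in> space ?G. 4 * real d \<le> (\<Sum>i<d. (g i - a i)\<^sup>2)}"
  define T2 where "T2 = {g \<in> space ?G. 2 \<le> \<bar>\<Sum>i<d. u i * (g i - a i)\<bar>}"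
  have [measurable]: "T1 \<in> sets ?G" "T2 \<in> sets ?G" unfolding T1_def T2_def by measurable
  have T1: "prob T1 \<le> 1/4" using gaussian_norm_tail[of 4 d a] d by (simp add: T1_def)
  have T2: "prob T2 \<le> 1/4" using gaussian_inner_tail[OF u, of 2 a] by (simp add: T2_def)
  define E where "E = space ?G - (T1 \<union> T2)"
  have Em [measurable]: "E \<in> sets ?G" unfolding E_def by measurable
  have "prob E = 1 - prob (T1 \<union> T2)" unfolding E_def by (intro prob_compl) auto
  moreover have "prob (T1 \<union> T2) \<le> prob T1 + prob T2" by (intro measure_Un_le) auto
  ultimately have E: "1/2 \<le> prob E" using T1 T2 by linarith
  have onE: "g \<in> good_dirs d c u" "- (s\<^sup>2 / 2 + 2 * s) \<le> (\<Sum>i<d. (a i)\<^sup>2 / 2 - a i * g i)" if g: "g \<in> E" for g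
  proof -
    define X where "X = (\<Sum>i<d. u i * g i)"
    define H where "H = (\<Sum>i<d. (g i - a i)\<^sup>2)"
    have ua: "(\<Sum>i<d. u i * a i) = s"
      using u by (simp add: a_def power2_eq_square mult.left_commute flip: sum_distrib_left)
    have "(\<Sum>i<d. u i * (g i - a i)) = X - s"
      by (simp add: right_diff_distrib sum_subtractf ua X_def)
    hence Xs: "\<bar>X - s\<bar> < 2" and H: "H < 4 * real d" using g by (auto simp: E_def T1_def T2_def H_def)
    have aa: "(\<Sum>i<d. (a i)\<^sup>2) = s\<^sup>2" using u by (simp add: a_def power_mult_distrib flip: sum_distrib_left)
    have ag: "(\<Sum>i<d. a i * g i) = s * X" by (simp add: a_def X_def sum_distrib_left mult.assoc)
    have "H = (\<Sum>i<d. (g i)\<^sup>2) - 2 * (\<Sum>i<d. a i * g i) + (\<Sum>i<d. (a i)\<^sup>2)"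
      by (simp add: H_def power2_diff sum.distrib sum_subtractf sum_distrib_left mult_ac)
    hence norm: "(\<Sum>i<d. (g i)\<^sup>2) = H + 2 * s * X - s\<^sup>2" by (simp add: aa ag)
    have "0 \<le> (X - s)\<^sup>2" by simp
    hence norm_le: "(\<Sum>i<d. (g i)\<^sup>2) \<le> X\<^sup>2 + 4 * real d" using H norm by (simp add: power2_diff mult_ac)
    define r where "r = sqrt (8 * c\<^sup>2 / (2 - c\<^sup>2))"
    have r: "r > 0" "r\<^sup>2 = 8 * c\<^sup>2 / (2 - c\<^sup>2)" using c2 c20 by (auto simp: r_def)
    have Xr: "r < X" using Xs by (simp add: s_def tilt_def r_def)
    have "r\<^sup>2 \<le> X\<^sup>2" using r Xr by (intro power_mono) auto
    hence key: "8 * c\<^sup>2 \<le> (2 - c\<^sup>2) * X\<^sup>2" using c2 r by (simp add: divide_le_eq mult.commute)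
    have "c\<^sup>2 * X\<^sup>2 + 4 * real d * c\<^sup>2 \<le> real d * X\<^sup>2"
    proof -
      have "4 * real d * c\<^sup>2 \<le> real d / 2 * ((2 - c\<^sup>2) * X\<^sup>2)" using mult_left_mono[OF key, of "real d / 2"] by simp
      moreover have "1 * (c\<^sup>2 * X\<^sup>2) \<le> real d / 2 * (c\<^sup>2 * X\<^sup>2)" using d by (intro mult_right_mono) auto
      ultimately show ?thesis by (simp add: algebra_simps)
    qed
    moreover have "c\<^sup>2 * (\<Sum>i<d. (g i)\<^sup>2) \<le> c\<^sup>2 * (X\<^sup>2 + 4 * real d)" using norm_le by (intro mult_left_mono) auto
    ultimately have "c\<^sup>2 * (\<Sum>i<d. (g i)\<^sup>2) \<le> real d * X\<^sup>2" by (simp add: algebra_simps)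
    moreover have "X \<noteq> 0" using Xr r by auto
    ultimately show "g \<in> good_dirs d c u" using g by (auto simp: good_dirs_def E_def space_gaussian X_def)
    have "s \<ge> 0" using r by (simp add: s_def tilt_def r_def)
    hence "s * X \<le> s * (s + 2)" using Xs by (intro mult_left_mono) auto
    moreover have "(\<Sum>i<d. (a i)\<^sup>2 / 2 - a i * g i) = s\<^sup>2 / 2 - s * X"
      by (simp add: sum_subtractf ag aa flip: sum_divide_distrib)
    ultimately show "- (s\<^sup>2 / 2 + 2 * s) \<le> (\<Sum>i<d. (a i)\<^sup>2 / 2 - a i * g i)"
      by (simp add: power2_eq_square algebra_simps)
  qed
  let ?e = "exp (- (s\<^sup>2 / 2 + 2 * s))"
  have "ennreal (?e / 2) = ennreal ?e * ennreal (1/2)" by (subst ennreal_mult[symmetric]) auto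
  also have "\<dots> \<le> ennreal ?e * emeasure ?G E"
    unfolding emeasure_eq_measure using E by (intro mult_left_mono ennreal_leI) auto
  also have "\<dots> = (\<integral>\<^sup>+g. ennreal ?e * indicator E g \<partial>?G)" by (simp add: nn_integral_cmult_indicator)
  also have "\<dots> \<le> (\<integral>\<^sup>+g. ennreal (exp (\<Sum>i<d. (a i)\<^sup>2 / 2 - a i * g i)) * indicator (good_dirs d c u) g \<partial>?G)"
  proof (rule nn_integral_mono)
    fix g
    show "ennreal ?e * indicator E g \<le> ennreal (exp (\<Sum>i<d. (a i)\<^sup>2 / 2 - a i * g i)) * indicator (good_dirs d c u) g"
    proof (cases "g \<in> E")
      case True
      show ?thesis using onE[OF True] True by (auto intro!: ennreal_leI)
    qed simp
  qed
  also have "\<dots> = emeasure (gaussian d (\<lambda>_. 0)) (good_dirs d c u)"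
    unfolding gaussian_shift[of d a] by (intro emeasure_density[symmetric]) measurable
  also have "\<dots> = ennreal (Z.prob (good_dirs d c u))" by (rule Z.emeasure_eq_measure)
  finally show ?thesis by (simp add: s_def)
qed

lemma dir_prob_pos: "0 < dir_prob c"
proof -
  have "0 < exp (- ((tilt c)\<^sup>2 / 2 + 2 * tilt c)) / 2" by simp
  thus ?thesis unfolding dir_prob_def by linarith
qed

text \<open>
  The expected number of good indices is at least \<open>dir_prob c * card J\<close>, so some \<open>g\<close> attains this number; it is
  then normalized.
\<close>
lemma exists_common_direction:
  fixes u :: "'j \<Rightarrow> nat \<Rightarrow> real"
  assumes J: "finite J" "J \<noteq> {}" and u: "\<And>j. j \<in> J \<Longrightarrow> (\<Sum>i<d. (u j i)\<^sup>2) = 1"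
    and c: "0 < c" "c < sqrt 2" and d: "2 \<le> d"
  obtains v where "(\<Sum>i<d. (v i)\<^sup>2) = 1"
    "dir_prob c * real (card J) \<le> real (card {j\<in>J. c / sqrt (real d) \<le> \<bar>\<Sum>i<d. u j i * v i\<bar>})"
proof -
  let ?G = "gaussian d (\<lambda>_. 0)"
  interpret prob_space ?G by (rule prob_space_gaussian)
  define h where "h = (\<lambda>g. \<Sum>j\<in>J. indicator (good_dirs d c (u j)) g :: real)"
  have h_card: "h g = real (card {j\<in>J. g \<in> good_dirs d c (u j)})" for g
    using J by (simp add: h_def indicator_def sum.If_cases Int_def)
  have int: "integrable ?G h" unfolding h_def 
    by (intro Bochner_Integration.integrable_sum integrable_real_indicator) (auto simp: emeasure_eq_measure)
  have "dir_prob c * real (card J) = (\<Sum>j\<in>J. dir_prob c)" by simp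
  also have "\<dots> \<le> (\<Sum>j\<in>J. prob (good_dirs d c (u j)))"
    using good_dirs_prob_small[OF u c(1)] good_dirs_prob_shift[OF u c d] d
    by (intro sum_mono) (auto simp: dir_prob_def)
  also have "\<dots> = expectation h" unfolding h_def
    by (subst Bochner_Integration.integral_sum) (auto intro!: integrable_real_indicator simp: emeasure_eq_measure)
  finally have le: "dir_prob c * real (card J) \<le> expectation h" .
  have "\<exists>g. dir_prob c * real (card J) \<le> h g"
  proof (rule ccontr)
    assume "\<nexists>g. dir_prob c * real (card J) \<le> h g"
    hence "expectation h < dir_prob c * real (card J)" by (intro expectation_less int) (auto simp: not_le)
    thus False using le by simp
  qed
  then obtain g where g: "dir_prob c * real (card J) \<le> h g" by blast
  define r where "r = sqrt (\<Sum>i<d. (g i)\<^sup>2)"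
  have r2: "r\<^sup>2 = (\<Sum>i<d. (g i)\<^sup>2)" by (simp add: r_def sum_nonneg)
  have "0 < dir_prob c * real (card J)" using dir_prob_pos J by (simp add: card_gt_0_iff)
  hence "0 < h g" using g by linarith
  hence "{j\<in>J. g \<in> good_dirs d c (u j)} \<noteq> {}" unfolding h_card using card_gt_0_iff by fastforce
  then obtain j where "j \<in> J" "g \<in> good_dirs d c (u j)" by blast
  hence "(\<Sum>i<d. u j i * g i) \<noteq> 0" by (simp add: good_dirs_def)
  then obtain i where "i < d" "g i \<noteq> 0" by (metis (no_types, lifting) lessThan_iff mult_zero_right sum.neutral)
  hence "0 < (\<Sum>i<d. (g i)\<^sup>2)" by (intro sum_pos2[of _ i]) auto
  hence r: "r > 0" by (simp add: r_def)
  show thesis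
  proof (rule that[of "\<lambda>i. g i / r"])
    show "(\<Sum>i<d. (g i / r)\<^sup>2) = 1"
      using r by (simp add: power_divide r2[symmetric] flip: sum_divide_distrib)
    have "{j\<in>J. g \<in> good_dirs d c (u j)} \<subseteq> {j\<in>J. c / sqrt (real d) \<le> \<bar>\<Sum>i<d. u j i * (g i / r)\<bar>}"
    proof clarify
      fix j assume "g \<in> good_dirs d c (u j)"
      hence "c\<^sup>2 * r\<^sup>2 \<le> real d * (\<Sum>i<d. u j i * g i)\<^sup>2" by (simp add: good_dirs_def r2)
      hence "sqrt ((c * r)\<^sup>2) \<le> sqrt (real d * (\<Sum>i<d. u j i * g i)\<^sup>2)" by (intro real_sqrt_le_mono) (simp add: power_mult_distrib)
      hence le: "c * r \<le> sqrt (real d) * \<bar>\<Sum>i<d. u j i * g i\<bar>" using c r by (simp add: real_sqrt_mult)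
      have eq: "(\<Sum>i<d. u j i * (g i / r)) = (\<Sum>i<d. u j i * g i) / r" by (simp add: sum_divide_distrib)
      show "c / sqrt (real d) \<le> \<bar>\<Sum>i<d. u j i * (g i / r)\<bar>"
        unfolding eq using le r d by (simp add: abs_divide field_simps)
    qed
    hence "card {j\<in>J. g \<in> good_dirs d c (u j)} \<le> card {j\<in>J. c / sqrt (real d) \<le> \<bar>\<Sum>i<d. u j i * (g i / r)\<bar>}"
      using J by (intro card_mono) auto
    thus "dir_prob c * real (card J) \<le> real (card {j\<in>J. c / sqrt (real d) \<le> \<bar>\<Sum>i<d. u j i * (g i / r)\<bar>})"
      using g unfolding h_card by linarith
  qed
qed

lemma tilt_mono:
  assumes "0 < b" "b \<le> c" "c < sqrt 2"
  shows "2 \<le> tilt b" "tilt b \<le> tilt c"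
proof -
  have c2: "c\<^sup>2 < 2" using assms real_sqrt_less_iff[of "c\<^sup>2" 2] by simp
  have bc: "b\<^sup>2 \<le> c\<^sup>2" using assms by (intro power_mono) auto
  have "8 * b\<^sup>2 / (2 - b\<^sup>2) \<le> 8 * c\<^sup>2 / (2 - c\<^sup>2)" using bc c2 by (intro frac_le) auto
  thus "tilt b \<le> tilt c" by (simp add: tilt_def)
  show "2 \<le> tilt b" using bc c2 by (simp add: tilt_def)
qed

lemma dir_prob_antimono:
  assumes "0 < b" "b \<le> c" "c < sqrt 2"
  shows "dir_prob c \<le> dir_prob b"
proof -
  have "(tilt b)\<^sup>2 \<le> (tilt c)\<^sup>2" using tilt_mono[OF assms] by (intro power_mono) auto
  hence "exp (- ((tilt c)\<^sup>2 / 2 + 2 * tilt c)) \<le> exp (- ((tilt b)\<^sup>2 / 2 + 2 * tilt b))"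
    using tilt_mono(2)[OF assms] by simp
  moreover have "sqrt b \<le> sqrt c" using assms by simp
  ultimately show ?thesis unfolding dir_prob_def using assms by linarith
qed

lemma dir_prob_le_1:
  assumes "0 < c" "c < sqrt 2"
  shows "dir_prob c \<le> 1"
proof -
  have "0 \<le> (tilt c)\<^sup>2 / 2 + 2 * tilt c"
    using tilt_mono(1)[of c c] assms by (intro add_nonneg_nonneg) auto
  hence "exp (- ((tilt c)\<^sup>2 / 2 + 2 * tilt c)) \<le> 1" by simp
  moreover have "0 \<le> sqrt c" using assms by simp
  ultimately show ?thesis unfolding dir_prob_def using assms by linarith
qed

text \<open>
  The geometric mean of \<open>c\<close> and \<open>sqrt 2\<close> lies strictly between them. A set of diameter at least \<open>1\<close> need not
  contain points at distance \<open>1\<close>, and the gap between \<open>c\<close> and the geometric mean compensates for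
  the missing length. The denominator turns a weakly decreasing function into a strictly decreasing one.
\<close>
definition gamma_fn :: "real \<Rightarrow> real" where
  "gamma_fn c = dir_prob (sqrt (sqrt 2 * c)) / (1 + c)"

lemma geometric_mean_sqrt2:
  assumes "0 < c" "c < sqrt 2"
  shows "c < sqrt (sqrt 2 * c)" "sqrt (sqrt 2 * c) < sqrt 2"
proof -
  have "c * c < sqrt 2 * c" using assms by (intro mult_strict_right_mono) auto
  thus "c < sqrt (sqrt 2 * c)" using assms by (intro real_less_rsqrt) (simp add: power2_eq_square)
  have "sqrt 2 * c < sqrt 2 * sqrt 2" using assms by (intro mult_strict_left_mono) auto
  thus "sqrt (sqrt 2 * c) < sqrt 2" by simp
qed

lemma gamma_fn_range: "gamma_fn \<in> {0<..<sqrt 2} \<rightarrow> {0<..1}"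
proof
  fix c :: real assume "c \<in> {0<..<sqrt 2}"
  hence c: "0 < c" "c < sqrt 2" by auto
  have "dir_prob (sqrt (sqrt 2 * c)) \<le> 1" using geometric_mean_sqrt2[OF c] c by (intro dir_prob_le_1) auto
  thus "gamma_fn c \<in> {0<..1}" using c dir_prob_pos by (simp add: gamma_fn_def divide_le_eq)
qed

lemma gamma_fn_antimono: "strict_antimono_on {0<..<sqrt 2} gamma_fn"
proof (rule monotone_onI)
  fix b c :: real assume "b \<in> {0<..<sqrt 2}" "c \<in> {0<..<sqrt 2}" and bc: "b < c"
  hence b: "0 < b" "b < sqrt 2" and c: "0 < c" "c < sqrt 2" by auto
  have "gamma_fn c < dir_prob (sqrt (sqrt 2 * c)) / (1 + b)"
    unfolding gamma_fn_def using bc b c dir_prob_pos by (intro divide_strict_left_mono) auto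
  also have "\<dots> \<le> gamma_fn b" unfolding gamma_fn_def using b c bc geometric_mean_sqrt2[OF c]
    by (intro divide_right_mono dir_prob_antimono) auto
  finally show "gamma_fn b > gamma_fn c" .
qed

lemma gamma_fn_tendsto: "(gamma_fn \<longlongrightarrow> 1) (at_right 0)"
proof (rule tendsto_sandwich)
  show "\<forall>\<^sub>F c in at_right 0. (1 - sqrt (sqrt (sqrt 2 * c)) - sqrt (sqrt 2 * c)) / (1 + c) \<le> gamma_fn c"
    using eventually_at_right_less[of "0::real"]
    by eventually_elim (auto simp: gamma_fn_def dir_prob_def intro!: divide_right_mono)
  have "\<forall>\<^sub>F c in at_right 0. c \<in> {0<..<sqrt 2}" by (intro eventually_at_right_real) simp
  thus "\<forall>\<^sub>F c in at_right 0. gamma_fn c \<le> 1" 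
    by eventually_elim (use gamma_fn_range in auto)
  have "((\<lambda>c. (1 - sqrt (sqrt (sqrt 2 * c)) - sqrt (sqrt 2 * c)) / (1 + c)) \<longlongrightarrow> 
      (1 - sqrt (sqrt (sqrt 2 * 0)) - sqrt (sqrt 2 * 0)) / (1 + 0)) (at_right 0)"
    by (intro tendsto_intros) auto
  thus "((\<lambda>c. (1 - sqrt (sqrt (sqrt 2 * c)) - sqrt (sqrt 2 * c)) / (1 + c)) \<longlongrightarrow> 1) (at_right 0)" by simp
qed simp

section \<open>Pairs of points at prescribed width\<close>

text \<open>
  Function types carry the product topology and no norm, so compactness of polytopes is derived from
  the continuity of convex combinations alone.
\<close>

lemma compact_convex_hull_finite:
  fixes Z :: "'a :: {real_vector, topological_space} set"
  assumes "finite Z" and cont: "\<And>a :: 'a. continuous_on UNIV (\<lambda>(t :: real, b). (1 - t) *\<^sub>R a + t *\<^sub>R b)"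
  shows "compact (convex hull Z)"
  using assms(1)
proof (induction Z rule: finite_induct)
  case (insert a Z)
  show ?case
  proof (cases "Z = {}")
    case False
    have "convex hull (insert a Z) = (\<lambda>(t, b). (1 - t) *\<^sub>R a + t *\<^sub>R b) ` ({0..1} \<times> (convex hull Z))"
    proof (intro equalityI subsetI)
      fix x assume "x \<in> convex hull (insert a Z)"
      then obtain s t b where "s \<ge> 0" "t \<ge> 0" "s + t = 1" "b \<in> convex hull Z" "x = s *\<^sub>R a + t *\<^sub>R b"
        by (auto simp: convex_hull_insert[OF False])
      moreover from this have "s = 1 - t" "t \<le> 1" by auto
      ultimately show "x \<in> (\<lambda>(t, b). (1 - t) *\<^sub>R a + t *\<^sub>R b) ` ({0..1} \<times> (convex hull Z))"
        by (intro image_eqI[of _ _ "(t, b)"]) auto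
    next
      fix x assume "x \<in> (\<lambda>(t, b). (1 - t) *\<^sub>R a + t *\<^sub>R b) ` ({0..1} \<times> (convex hull Z))"
      then obtain t b where tb: "0 \<le> t" "t \<le> 1" "b \<in> convex hull Z" "x = (1 - t) *\<^sub>R a + t *\<^sub>R b" by auto
      have "a \<in> convex hull (insert a Z)" "b \<in> convex hull (insert a Z)"
        using tb(3) hull_mono[of Z "insert a Z" convex] by (auto intro: hull_inc)
      thus "x \<in> convex hull (insert a Z)" unfolding tb(4) using tb(1,2)
        by (intro convexD[OF convex_convex_hull]) auto
    qed
    also have "compact \<dots>"
      using insert.IH by (intro compact_continuous_image continuous_on_subset[OF cont] compact_Times) auto
    finally show ?thesis .
  qed simp
qed simp

type_synonym point_pair = "(nat \<Rightarrow> real) \<times> (nat \<Rightarrow> real)"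

lemma continuous_pair_coordinates:
  "continuous_on S (\<lambda>p :: point_pair. fst p i)" "continuous_on S (\<lambda>p :: point_pair. snd p i)"
  by (rule continuous_on_product_then_coordinatewise, intro continuous_intros)+

lemma compact_convex_hull_pairs:
  fixes Z :: "point_pair set"
  assumes "finite Z"
  shows "compact (convex hull Z)"
proof (rule compact_convex_hull_finite[OF assms])
  fix a :: point_pair
  have 1: "continuous_on UNIV (\<lambda>q :: real \<times> point_pair. fst (snd q) i)" for i
    by (rule continuous_on_product_then_coordinatewise, intro continuous_intros)
  have 2: "continuous_on UNIV (\<lambda>q :: real \<times> point_pair. snd (snd q) i)" for i
    by (rule continuous_on_product_then_coordinatewise, intro continuous_intros)
  have "continuous_on UNIV (\<lambda>q :: real \<times> point_pair. 
     (\<lambda>i. (1 - fst q) * fst a i + fst q * fst (snd q) i, \<lambda>i. (1 - fst q) * snd a i + fst q * snd (snd q) i))"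
    by (intro continuous_on_Pair continuous_on_coordinatewise_then_product continuous_intros 1 2)
  also have "(\<lambda>q :: real \<times> point_pair. 
     (\<lambda>i. (1 - fst q) * fst a i + fst q * fst (snd q) i, \<lambda>i. (1 - fst q) * snd a i + fst q * snd (snd q) i))
     = (\<lambda>(t, b). (1 - t) *\<^sub>R a + t *\<^sub>R b)"
    by (auto simp: fun_eq_iff prod_eq_iff plus_fun_def)
  finally show "continuous_on UNIV (\<lambda>(t :: real, b). (1 - t) *\<^sub>R a + t *\<^sub>R b)" .
qed

definition sqnorm :: "nat \<Rightarrow> point_pair \<Rightarrow> real" where
  "sqnorm d p = (\<Sum>i<d. (fst p i)\<^sup>2 + (snd p i)\<^sup>2)"

lemma continuous_sqnorm: "continuous_on UNIV (sqnorm d)"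
  unfolding sqnorm_def by (intro continuous_intros continuous_pair_coordinates)

lemma sqnorm_convex_combination:
  assumes "s + t = 1"
  shows "sqnorm d (s *\<^sub>R p + t *\<^sub>R q) = s * sqnorm d p + t * sqnorm d q - s * t * sqnorm d (p - q)"
proof -
  have s: "s = 1 - t" using assms by simp
  have *: "(s * x + t * y)\<^sup>2 = s * x\<^sup>2 + t * y\<^sup>2 - s * t * (x - y)\<^sup>2" for x y
    unfolding s by (simp add: power2_eq_square algebra_simps)
  show ?thesis
    by (simp add: sqnorm_def * plus_fun_def fun_diff_def sum.distrib sum_subtractf sum_distrib_left algebra_simps)
qed

definition slab_pairs :: "nat \<Rightarrow> (nat \<Rightarrow> real) \<Rightarrow> real \<Rightarrow> point_pair set" where
  "slab_pairs d v w = {(x, y). x \<in> topspace (Euclidean_space d) \<and> y \<in> topspace (Euclidean_space d) \<and>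
     (\<Sum>i<d. v i * (y i - x i)) = w}"

lemma inner_convex_combination:
  fixes v x y x' y' :: "nat \<Rightarrow> real"
  assumes "s + t = (1::real)" "(\<Sum>i<d. v i * (y i - x i)) = w" "(\<Sum>i<d. v i * (y' i - x' i)) = w"
  shows "(\<Sum>i<d. v i * ((s *\<^sub>R y + t *\<^sub>R y') i - (s *\<^sub>R x + t *\<^sub>R x') i)) = w"
proof -
  have "(\<Sum>i<d. v i * ((s *\<^sub>R y + t *\<^sub>R y') i - (s *\<^sub>R x + t *\<^sub>R x') i)) =
     s * (\<Sum>i<d. v i * (y i - x i)) + t * (\<Sum>i<d. v i * (y' i - x' i))"
    by (simp add: sum_distrib_left sum.distrib[symmetric] plus_fun_def algebra_simps)
  also have "\<dots> = (s + t) * w" unfolding assms(2,3) by (simp add: distrib_right)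
  finally show ?thesis using assms(1) by simp
qed

lemma convex_slab_pairs: "convex (slab_pairs d v w)"
proof (rule convexI)
  fix p q :: point_pair and s t :: real
  assume "p \<in> slab_pairs d v w" "q \<in> slab_pairs d v w" "0 \<le> s" "0 \<le> t" "s + t = 1"
  thus "s *\<^sub>R p + t *\<^sub>R q \<in> slab_pairs d v w"
    using inner_convex_combination[of s t v "snd p" "fst p" d w "snd q" "fst q"]
    by (auto simp: slab_pairs_def case_prod_beta topspace_Euclidean_space plus_fun_def)
qed

lemma slab_pairs_support:
  assumes "p \<in> slab_pairs d v w" "d \<le> i"
  shows "fst p i = 0" "snd p i = 0"
  using assms by (auto simp: slab_pairs_def topspace_Euclidean_space)

lemma sqnorm_strictly_convex:
  assumes "p \<in> slab_pairs d v w" "q \<in> slab_pairs d v w" "p \<noteq> q" "sqnorm d p = sqnorm d q"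
  shows "sqnorm d ((1/2) *\<^sub>R p + (1/2) *\<^sub>R q) < sqnorm d p"
proof -
  have "\<exists>i<d. fst p i \<noteq> fst q i \<or> snd p i \<noteq> snd q i"
  proof (rule ccontr)
    assume no: "\<not> ?thesis"
    have "fst p i = fst q i \<and> snd p i = snd q i" for i
    proof (cases "i < d")
      case False
      thus ?thesis using slab_pairs_support[OF assms(1)] slab_pairs_support[OF assms(2)] by simp
    qed (use no in blast)
    hence "fst p = fst q" "snd p = snd q" by (simp_all add: fun_eq_iff)
    thus False using assms(3) by (simp add: prod_eq_iff)
  qed
  then obtain i where i: "i < d" "fst p i \<noteq> fst q i \<or> snd p i \<noteq> snd q i" by blast
  have "0 < sqnorm d (p - q)" unfolding sqnorm_def
    by (rule sum_pos2[of _ i]) (use i in \<open>auto simp: fun_diff_def add_pos_nonneg add_nonneg_pos\<close>)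
  thus ?thesis using assms(4) by (subst sqnorm_convex_combination) auto
qed

lemma convex_sqnorm_sublevel: "convex {p \<in> slab_pairs d v w. sqnorm d p < r}"
proof (rule convexI)
  fix p q :: point_pair and s t :: real
  assume p: "p \<in> {p \<in> slab_pairs d v w. sqnorm d p < r}" and q: "q \<in> {p \<in> slab_pairs d v w. sqnorm d p < r}"
    and st: "0 \<le> s" "0 \<le> t" "s + t = 1"
  have "0 \<le> sqnorm d (p - q)" unfolding sqnorm_def by (intro sum_nonneg) auto
  hence "sqnorm d (s *\<^sub>R p + t *\<^sub>R q) \<le> s * sqnorm d p + t * sqnorm d q"
    using st by (subst sqnorm_convex_combination) auto
  also have "\<dots> < r" using p q st by (intro convex_bound_lt) auto
  finally show "s *\<^sub>R p + t *\<^sub>R q \<in> {p \<in> slab_pairs d v w. sqnorm d p < r}"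
    using convexD[OF convex_slab_pairs, of p d v w q s t] p q st by auto
qed

text \<open>
  The slab lies in a space of dimension \<open>2d\<close> and, as \<open>w \<noteq> 0\<close>, on a hyperplane missing the origin. There every
  linear relation among points has coefficient sum zero, so linear dependence is affine
  dependence.
\<close>
lemma affine_dependent_slab_pairs:
  assumes w: "w \<noteq> 0" and Z: "finite Z" "Z \<subseteq> slab_pairs d v w" "2 * d < card Z"
  shows "affine_dependent Z"
proof -
  define e where "e = (\<lambda>i j :: nat. if j = i then 1 else 0 :: real)"
  define Bs where "Bs = (\<lambda>i. (e i, 0)) ` {..<d} \<union> (\<lambda>i. (0, e i)) ` {..<d}"
  have fB: "finite Bs" by (simp add: Bs_def)
  have "card Bs \<le> card ((\<lambda>i. (e i, 0 :: nat \<Rightarrow> real)) ` {..<d}) + card ((\<lambda>i. (0 :: nat \<Rightarrow> real, e i)) ` {..<d})"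
    unfolding Bs_def by (rule card_Un_le)
  also have "\<dots> \<le> d + d" by (intro add_mono) (use card_image_le[of "{..<d}"] in auto)
  finally have cB: "card Bs \<le> 2 * d" by simp
  have sumapp: "(\<Sum>i<d. c i *\<^sub>R e i) j = (if j < d then c j else 0)" for c :: "nat \<Rightarrow> real" and j
    by (auto simp: sum_fun_apply e_def if_distrib sum.delta cong: if_cong)
  have "Z \<subseteq> span Bs"
  proof
    fix p assume "p \<in> Z"
    hence sup: "fst p j = 0" "snd p j = 0" if "j \<ge> d" for j
      using slab_pairs_support[of p d v w j] Z(2) that by auto
    have "p = (\<Sum>i<d. fst p i *\<^sub>R (e i, 0)) + (\<Sum>i<d. snd p i *\<^sub>R (0, e i))"
    proof -
      have "fst p = (\<Sum>i<d. fst p i *\<^sub>R e i)" "snd p = (\<Sum>i<d. snd p i *\<^sub>R e i)"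
        using sup by (auto simp: fun_eq_iff sumapp not_less)
      thus ?thesis by (simp add: prod_eq_iff fst_sum snd_sum)
    qed
    also have "\<dots> \<in> span Bs"
      by (intro span_add span_sum span_scale span_base) (auto simp: Bs_def)
    finally show "p \<in> span Bs" .
  qed
  hence "dependent Z" using independent_span_bound[OF fB, of Z] cB Z(3) by linarith
  then obtain U p where U: "p \<in> Z" "U p \<noteq> 0" "(\<Sum>q\<in>Z. U q *\<^sub>R q) = 0"
    using dependent_finite[OF Z(1)] by auto
  define \<phi> where "\<phi> = (\<lambda>p :: point_pair. \<Sum>i<d. v i * (snd p i - fst p i))"
  have "linear \<phi>"
    by (rule linearI) (simp_all add: \<phi>_def plus_fun_def sum.distrib[symmetric] sum_distrib_left algebra_simps)
  hence "\<phi> (\<Sum>q\<in>Z. U q *\<^sub>R q) = (\<Sum>q\<in>Z. U q * \<phi> q)"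
    by (simp add: linear_sum linear_cmul)
  also have "\<dots> = (\<Sum>q\<in>Z. U q * w)"
    using Z(2) by (intro sum.cong) (auto simp: \<phi>_def slab_pairs_def)
  finally have "sum U Z * w = 0" using U(3) by (simp add: \<phi>_def sum_distrib_right)
  hence "sum U Z = 0" using w by simp
  thus ?thesis using U Z(1) by (auto simp: affine_dependent_explicit_finite)
qed

section \<open>Fractional Helly theorem for the diameter\<close>

theorem theorem1p2:
  shows "\<exists>\<gamma> :: real \<Rightarrow> real.
    \<gamma> \<in> {0<..<sqrt 2} \<rightarrow> {0<..1} \<and>
    strict_antimono_on {0<..<sqrt 2} \<gamma> \<and>
    (\<gamma> \<longlongrightarrow> 1) (at_right 0) \<and>
    (\<forall>c \<in> {0<..<sqrt 2}. \<forall>\<alpha> \<in> {0<..1::real}. \<forall>d \<ge> (2::nat). \<forall>\<F> :: (nat \<Rightarrow> real) set set.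
      let \<beta> = 1 - (1 - \<alpha> * \<gamma> c) powr (1 / (2 * real d)) in
        finite \<F> \<longrightarrow>
        2 * d \<le> card \<F> \<longrightarrow>
        (\<forall>K \<in> \<F>. K \<subseteq> topspace (Euclidean_space d) \<and> convex K) \<longrightarrow>
        real (card {\<H>. \<H> \<subseteq> \<F> \<and> card \<H> = 2 * d \<and> euclid_diameter d (\<Inter>\<H>) \<ge> 1})
          \<ge> \<alpha> * real (card \<F> choose (2 * d)) \<longrightarrow>
        (\<exists>\<G> \<subseteq> \<F>. real (card \<G>) \<ge> \<beta> * real (card \<F>) \<and>
          euclid_diameter d (\<Inter>\<G>) \<ge> ennreal (c * real d powr (- 1 / 2))))"
proof -
  have main: "\<exists>\<G> \<subseteq> \<F>. real (card \<G>) \<ge> (1 - (1 - \<alpha> * gamma_fn c) powr (1 / (2 * real d))) * real (card \<F>) \<and>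
          euclid_diameter d (\<Inter>\<G>) \<ge> ennreal (c * real d powr (- 1 / 2))"
    if c: "0 < c" "c < sqrt 2" and \<alpha>: "0 < \<alpha>" "\<alpha> \<le> 1" and d: "2 \<le> d" and fin: "finite \<F>" and card: "2 * d \<le> card \<F>"
      and K: "\<And>K. K \<in> \<F> \<Longrightarrow> K \<subseteq> topspace (Euclidean_space d)" "\<And>K. K \<in> \<F> \<Longrightarrow> convex K"
      and many: "\<alpha> * real (card \<F> choose (2 * d)) \<le> real (card {\<H>. \<H> \<subseteq> \<F> \<and> card \<H> = 2 * d \<and> euclid_diameter d (\<Inter>\<H>) \<ge> 1})"
    for c \<alpha> :: real and d :: nat and \<F> :: "(nat \<Rightarrow> real) set set"
  proof -
    define J where "J = {\<H>. \<H> \<subseteq> \<F> \<and> card \<H> = 2 * d \<and> euclid_diameter d (\<Inter>\<H>) \<ge> 1}"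
    have finJ: "finite J" unfolding J_def using fin by (auto intro: finite_subset[of _ "Pow \<F>"])
    have "0 < \<alpha> * real (card \<F> choose (2 * d))" using \<alpha> card by simp
    hence "0 < card J" using many unfolding J_def by linarith
    hence Jne: "J \<noteq> {}" by auto
    define c' where "c' = sqrt (sqrt 2 * c)"
    have c': "c < c'" "c' < sqrt 2" unfolding c'_def by (rule geometric_mean_sqrt2[OF c])+
    define w where "w = c / sqrt (real d)"
    have w: "0 < w" using c d by (simp add: w_def)
    \<comment> \<open>Points at distance above \<open>c / c'\<close>, which is below \<open>1\<close>: their width \<open>c' / sqrt d\<close> relative to the distance becomes \<open>w\<close>.\<close>
    have "\<forall>\<H>\<in>J. \<exists>xy. (\<forall>K\<in>\<H>. fst xy \<in> K \<and> snd xy \<in> K) \<and> c / c' < euclid_dist d (fst xy) (snd xy)"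
    proof
      fix \<H> assume H: "\<H> \<in> J"
      have "ennreal (c / c') < 1" using c c' by (simp add: ennreal_less_one_iff)
      also have "1 \<le> euclid_diameter d (\<Inter>\<H>)" using H by (simp add: J_def)
      finally have "ennreal (c / c') < euclid_diameter d (\<Inter>\<H>)" .
      then obtain x y where "x \<in> \<Inter>\<H>" "y \<in> \<Inter>\<H>" "ennreal (c / c') < ennreal (euclid_dist d x y)"
        unfolding euclid_diameter_def less_SUP_iff by auto
      thus "\<exists>xy. (\<forall>K\<in>\<H>. fst xy \<in> K \<and> snd xy \<in> K) \<and> c / c' < euclid_dist d (fst xy) (snd xy)"
        using c c' by (intro exI[of _ "(x, y)"]) (auto simp: ennreal_less_iff)
    qed
    from bchoice[OF this] obtain xy where xy: "\<forall>\<H>\<in>J. (\<forall>K\<in>\<H>. fst (xy \<H>) \<in> K \<and> snd (xy \<H>) \<in> K) \<and> 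
      c / c' < euclid_dist d (fst (xy \<H>)) (snd (xy \<H>))" by (elim exE)
    define D where "D = (\<lambda>\<H>. euclid_dist d (fst (xy \<H>)) (snd (xy \<H>)))"
    define u where "u = (\<lambda>\<H> i. (snd (xy \<H>) i - fst (xy \<H>) i) / D \<H>)"
    have D: "c / c' < D \<H>" "0 < D \<H>" if "\<H> \<in> J" for \<H>
    proof -
      show "c / c' < D \<H>" using xy that by (auto simp: D_def)
      moreover have "0 < c / c'" using c c' by simp
      ultimately show "0 < D \<H>" by linarith
    qed
    have unorm: "(\<Sum>i<d. (u \<H> i)\<^sup>2) = 1" if "\<H> \<in> J" for \<H>
    proof -
      have "(D \<H>)\<^sup>2 = (\<Sum>i<d. (fst (xy \<H>) i - snd (xy \<H>) i)\<^sup>2)"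
        by (simp add: D_def euclid_dist_def L2_set_def sum_nonneg)
      also have "\<dots> = (\<Sum>i<d. (snd (xy \<H>) i - fst (xy \<H>) i)\<^sup>2)" by (simp add: power2_commute)
      finally have "(\<Sum>i<d. (snd (xy \<H>) i - fst (xy \<H>) i)\<^sup>2) = (D \<H>)\<^sup>2" by simp
      thus ?thesis using D(2)[OF that]
        by (simp add: u_def power_divide flip: sum_divide_distrib)
    qed
    obtain v where v: "(\<Sum>i<d. (v i)\<^sup>2) = 1"
      and vmany: "dir_prob c' * real (card J) \<le> real (card {\<H>\<in>J. c' / sqrt (real d) \<le> \<bar>\<Sum>i<d. u \<H> i * v i\<bar>})"
    proof (rule exists_common_direction[OF finJ Jne _ _ c'(2) d, of u])
      show "0 < c'" using c c' by linarith
    qed (use unorm in blast)+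
    define C where "C = (\<lambda>K :: (nat \<Rightarrow> real) set. {(x, y). x \<in> K \<and> y \<in> K \<and> (\<Sum>i<d. v i * (y i - x i)) = w})"
    have good: "(\<Inter>K\<in>\<H>. C K) \<noteq> {}" if H: "\<H> \<in> J" "c' / sqrt (real d) \<le> \<bar>\<Sum>i<d. u \<H> i * v i\<bar>" for \<H>
    proof -
      define x y where "x = fst (xy \<H>)" and "y = snd (xy \<H>)"
      have xyK: "x \<in> K" "y \<in> K" if "K \<in> \<H>" for K using xy H that by (auto simp: x_def y_def)
      have "w = c / c' * (c' / sqrt (real d))" using c c' by (simp add: w_def)
      also have "\<dots> \<le> D \<H> * \<bar>\<Sum>i<d. u \<H> i * v i\<bar>"
        using D[OF H(1)] H(2) c c' by (intro mult_mono) auto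
      also have "\<dots> = \<bar>D \<H> * (\<Sum>i<d. u \<H> i * v i)\<bar>" using D(2)[OF H(1)] by (simp add: abs_mult)
      also have "D \<H> * (\<Sum>i<d. u \<H> i * v i) = (\<Sum>i<d. v i * (y i - x i))"
        using D(2)[OF H(1)] by (simp add: u_def x_def y_def sum_distrib_left mult.commute)
      finally have wle: "w \<le> \<bar>\<Sum>i<d. v i * (y i - x i)\<bar>" .
      \<comment> \<open>Order the two points so that the width is positive, then shorten the segment to width exactly \<open>w\<close>.\<close>
      obtain x' y' where x'y': "w \<le> (\<Sum>i<d. v i * (y' i - x' i))" "\<And>K. K \<in> \<H> \<Longrightarrow> x' \<in> K \<and> y' \<in> K"
      proof (cases "0 \<le> (\<Sum>i<d. v i * (y i - x i))")
        case True
        thus thesis using that[of y x] wle xyK by auto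
      next
        case False
        have "(\<Sum>i<d. v i * (x i - y i)) = - (\<Sum>i<d. v i * (y i - x i))"
          by (simp add: sum_negf[symmetric] algebra_simps)
        thus thesis using that[of x y] wle xyK False by auto
      qed
      define l where "l = (\<Sum>i<d. v i * (y' i - x' i))"
      define t where "t = w / l"
      have l: "0 < l" "w \<le> l" using x'y'(1) w by (auto simp: l_def)
      have t: "0 \<le> t" "t \<le> 1" "t * l = w" using l w by (auto simp: t_def)
      define z where "z = (1 - t) *\<^sub>R x' + t *\<^sub>R y'"
      have "(\<Sum>i<d. v i * (z i - x' i)) = t * l"
        by (simp add: l_def z_def plus_fun_def sum_distrib_left algebra_simps)
      moreover have "z \<in> K" if "K \<in> \<H>" for K
      proof -
        have "convex K" using K(2) H(1) that by (auto simp: J_def)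
        thus ?thesis unfolding z_def using x'y'(2)[OF that] t by (intro convexD) auto
      qed
      ultimately have "(x', z) \<in> (\<Inter>K\<in>\<H>. C K)" using x'y'(2) t(3) by (auto simp: C_def)
      thus ?thesis by blast
    qed
    have Cconv: "convex (C K)" if KF: "K \<in> \<F>" for K
    proof (rule convexI)
      fix p q :: point_pair and s t :: real
      assume p: "p \<in> C K" and q: "q \<in> C K" and st: "0 \<le> s" "0 \<le> t" "s + t = 1"
      have "s *\<^sub>R fst p + t *\<^sub>R fst q \<in> K" "s *\<^sub>R snd p + t *\<^sub>R snd q \<in> K"
        using p q st K(2)[OF KF] by (auto simp: C_def intro!: convexD)
      thus "s *\<^sub>R p + t *\<^sub>R q \<in> C K"
        using inner_convex_combination[of s t v "snd p" "fst p" d w "snd q" "fst q"] p q st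
        by (auto simp: C_def case_prod_beta)
    qed
    have Csub: "C K \<subseteq> slab_pairs d v w" if "K \<in> \<F>" for K
      using K(1)[OF that] by (auto simp: C_def slab_pairs_def)
    have "gamma_fn c \<le> dir_prob c'"
      using dir_prob_pos[of c'] c by (simp add: gamma_fn_def c'_def divide_le_eq)
    hence "gamma_fn c * (\<alpha> * real (card \<F> choose (2 * d))) \<le> dir_prob c' * real (card J)"
      using many \<alpha> dir_prob_pos[of c'] by (intro mult_mono) (auto simp: J_def)
    also note vmany
    also have "real (card {\<H>\<in>J. c' / sqrt (real d) \<le> \<bar>\<Sum>i<d. u \<H> i * v i\<bar>}) 
       \<le> real (card {S. S \<subseteq> \<F> \<and> card S = 2 * d \<and> (\<Inter>K\<in>S. C K) \<noteq> {}})"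
    proof (intro of_nat_mono card_mono)
      show "finite {S. S \<subseteq> \<F> \<and> card S = 2 * d \<and> (\<Inter>K\<in>S. C K) \<noteq> {}}"
        using fin by (auto intro: finite_subset[of _ "Pow \<F>"])
      show "{\<H>\<in>J. c' / sqrt (real d) \<le> \<bar>\<Sum>i<d. u \<H> i * v i\<bar>} \<subseteq> {S. S \<subseteq> \<F> \<and> card S = 2 * d \<and> (\<Inter>K\<in>S. C K) \<noteq> {}}"
      proof
        fix \<H> assume "\<H> \<in> {\<H>\<in>J. c' / sqrt (real d) \<le> \<bar>\<Sum>i<d. u \<H> i * v i\<bar>}"
        thus "\<H> \<in> {S. S \<subseteq> \<F> \<and> card S = 2 * d \<and> (\<Inter>K\<in>S. C K) \<noteq> {}}"
          using good[of \<H>] by (simp add: J_def)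
      qed
    qed
    finally have many': "(\<alpha> * gamma_fn c) * real (card \<F> choose (2 * d)) 
       \<le> real (card {S. S \<subseteq> \<F> \<and> card S = 2 * d \<and> (\<Inter>K\<in>S. C K) \<noteq> {}})" by (simp add: mult_ac)
    have "\<exists>S\<subseteq>\<F>. (\<Inter>K\<in>S. C K) \<noteq> {} \<and> (1 - (1 - \<alpha> * gamma_fn c) powr (1 / real (2 * d))) * real (card \<F>) \<le> real (card S)"
    proof (rule fractional_helly[where A = "slab_pairs d v w" and Q = "sqnorm d"])
      show "affine_dependent Z" if "finite Z" "Z \<subseteq> slab_pairs d v w" "2 * d < card Z" for Z
        using affine_dependent_slab_pairs[OF _ that] w by simp
    qed (use fin Cconv Csub convex_slab_pairs d card compact_convex_hull_pairs continuous_sqnorm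
          sqnorm_strictly_convex convex_sqnorm_sublevel many' in auto)
    then obtain \<G> where G: "\<G> \<subseteq> \<F>" "(\<Inter>K\<in>\<G>. C K) \<noteq> {}"
      "(1 - (1 - \<alpha> * gamma_fn c) powr (1 / real (2 * d))) * real (card \<F>) \<le> real (card \<G>)" by blast
    have "0 < \<alpha> * gamma_fn c" "\<alpha> * gamma_fn c \<le> 1"
      using gamma_fn_range c \<alpha> by (auto simp: Pi_iff intro!: mult_le_one mult_pos_pos less_imp_le[of 0 "gamma_fn c"])
    hence "(1 - \<alpha> * gamma_fn c) powr (1 / real (2 * d)) < 1 powr (1 / real (2 * d))"
      using d by (intro powr_less_mono2) auto
    hence "0 < (1 - (1 - \<alpha> * gamma_fn c) powr (1 / real (2 * d))) * real (card \<F>)"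
      using card d by (intro mult_pos_pos) auto
    hence "0 < card \<G>" using G(3) by linarith
    then obtain K0 where K0: "K0 \<in> \<G>" by fastforce
    from G(2) obtain x y where xyC: "\<And>K. K \<in> \<G> \<Longrightarrow> (x, y) \<in> C K" by fast
    have xyw: "(\<Sum>i<d. v i * (y i - x i)) = w" using xyC[OF K0] by (simp add: C_def)
    have "w = (\<Sum>i<d. v i * (y i - x i))" by (simp add: xyw)
    also have "\<dots> \<le> (\<Sum>i<d. \<bar>v i\<bar> * \<bar>y i - x i\<bar>)" by (intro sum_mono) (simp flip: abs_mult)
    also have "\<dots> \<le> L2_set v {..<d} * L2_set (\<lambda>i. y i - x i) {..<d}" by (rule L2_set_mult_ineq)
    also have "\<dots> = euclid_dist d x y"
      using v by (simp add: L2_set_def euclid_dist_def power2_commute)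
    finally have "ennreal w \<le> ennreal (euclid_dist d x y)" by (rule ennreal_leI)
    also have "\<dots> \<le> euclid_diameter d (\<Inter>\<G>)"
      unfolding euclid_diameter_def using xyC by (intro SUP_upper2[of "(x, y)"]) (auto simp: C_def)
    finally have "ennreal w \<le> euclid_diameter d (\<Inter>\<G>)" .
    moreover have "real d powr (- 1 / 2) = 1 / sqrt (real d)"
      using powr_minus_divide[of "real d" "1 / 2"] powr_half_sqrt[of "real d"] by simp
    hence "w = c * real d powr (- 1 / 2)" by (simp add: w_def)
    ultimately show ?thesis using G(1,3) by auto
  qed
  show ?thesis
    by (rule exI[of _ gamma_fn]) (use gamma_fn_range gamma_fn_antimono gamma_fn_tendsto main in \<open>auto simp: Let_def\<close>)
qed

end
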